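(* Let $\Sigma^*\to G$, $w\mapsto\overline w$, be a choice of generators for a group $G$, let $\#$ be a letter not in $\Sigma$, and let $\Sigma_\epsilon=\Sigma\cup\{\epsilon\}$ where $\epsilon$ is the empty word. For a combing $R\subset\Sigma^*$ and $g\in G$ put $C(g)=\{u\#w\mid u,w\in R,\ \overline u\, g\,\overline w=1\}$. Then there exists a combing $R\subset\Sigma^*$ such that $C(\overline a)$ is context-free for all $a\in\Sigma_\epsilon$ if and only if $G$ is asynchronously automatic with respect to some combing $R'\subset\Sigma^*$ that is closed under taking formal inverses (i.e. $w\in R'$ implies $w^{-1}\in R'$).
   Context: A choice of generators for a group $G$ consists of a finite alphabet $\Sigma$ equipped with formal inverses (a permutation $a\mapsto a^{-1}$ of $\Sigma$ all of whose orbits have length two, extended to $\Sigma^*$ by $(wv)^{-1}=v^{-1}w^{-1}$) together with a surjective monoid homomorphism $\Sigma^*\to G$, $w\mapsto\overline{w}$, satisfying $\overline{w^{-1}}=\overline{w}^{-1}$. A combing is a language $R\subset\Sigma^*$ mapping onto $G$. A rational transduction $\Sigma^*\to\Sigma^*$ is a rational subset of the monoid $\Sigma^*\times\Sigma^*$ (i.e. a subset in the closure of the finite subsets under union, product and generation of submonoid; equivalently a set of labels of accepted paths of a finite automaton with edge labels in $\Sigma^*\times\Sigma^*$). $G$ is asynchronously automatic with respect to a combing $R'$ if $R'$ is a regular language and for every $a\in\Sigma_\epsilon$ the relation $\{(u,w)\mid u,w\in R',\ \overline u\,\overline a=\overline w\}$ is a rational transduction (this is equivalent to the standard definition via asynchronous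 automata). *)

theory Defs
  imports "HOL-Algebra.Group"
begin

inductive_set submonoid_gen :: "('m \<Rightarrow> 'm \<Rightarrow> 'm) \<Rightarrow> 'm \<Rightarrow> 'm set \<Rightarrow> 'm set"
  for f e A where
  sg_unit: "e \<in> submonoid_gen f e A"
| sg_step: "x \<in> A \<Longrightarrow> y \<in> submonoid_gen f e A \<Longrightarrow> f x y \<in> submonoid_gen f e A"

inductive_set rational_subsets :: "('m \<Rightarrow> 'm \<Rightarrow> 'm) \<Rightarrow> 'm \<Rightarrow> 'm set \<Rightarrow> 'm set set"
  for f e M where
  rs_finite: "finite A \<Longrightarrow> A \<subseteq> M \<Longrightarrow> A \<in> rational_subsets f e M"
| rs_union: "A \<in> rational_subsets f e M \<Longrightarrow> B \<in> rational_subsets f e M \<Longrightarrow>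
     A \<union> B \<in> rational_subsets f e M"
| rs_prod: "A \<in> rational_subsets f e M \<Longrightarrow> B \<in> rational_subsets f e M \<Longrightarrow>
     {f x y | x y. x \<in> A \<and> y \<in> B} \<in> rational_subsets f e M"
| rs_star: "A \<in> rational_subsets f e M \<Longrightarrow> submonoid_gen f e A \<in> rational_subsets f e M"

definition regular_lang :: "'a set \<Rightarrow> 'a list set \<Rightarrow> bool" where
  "regular_lang Sig L \<longleftrightarrow> L \<in> rational_subsets (@) [] (lists Sig)"

definition rational_transduction :: "'a set \<Rightarrow> ('a list \<times> 'a list) set \<Rightarrow> bool" where
  "rational_transduction Sig T \<longleftrightarrow>
     T \<in> rational_subsets (\<lambda>(u1, v1) (u2, v2). (u1 @ u2, v1 @ v2)) ([], [])
            (lists Sig \<times> lists Sig)"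

text \<open>A context-free grammar is a finite set of productions (A, rhs) with nonterminals
  represented by natural numbers; rhs is a word over terminals (Inl) and nonterminals (Inr).
  cfg_gen P s w: the sentential form s derives the terminal word w.\<close>
inductive cfg_gen :: "(nat \<times> ('a + nat) list) set \<Rightarrow> ('a + nat) list \<Rightarrow> 'a list \<Rightarrow> bool"
  for P where
  cg_nil: "cfg_gen P [] []"
| cg_term: "cfg_gen P rest v \<Longrightarrow> cfg_gen P (Inl a # rest) (a # v)"
| cg_nonterm: "(A, rhs) \<in> P \<Longrightarrow> cfg_gen P rhs u \<Longrightarrow> cfg_gen P rest v \<Longrightarrow>
     cfg_gen P (Inr A # rest) (u @ v)"

definition cfg_lang :: "(nat \<times> ('a + nat) list) set \<Rightarrow> nat \<Rightarrow> 'a list set" where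
  "cfg_lang P S = {w. cfg_gen P [Inr S] w}"

definition context_free :: "'a set \<Rightarrow> 'a list set \<Rightarrow> bool" where
  "context_free T L \<longleftrightarrow> L \<subseteq> lists T \<and>
     (\<exists>P S. finite P \<and> (\<forall>(A, rhs) \<in> P. \<forall>x \<in> set rhs. case x of Inl a \<Rightarrow> a \<in> T | Inr _ \<Rightarrow> True)
            \<and> cfg_lang P S = L)"

definition word_inv :: "('a \<Rightarrow> 'a) \<Rightarrow> 'a list \<Rightarrow> 'a list" where
  "word_inv iv w = rev (map iv w)"

definition choice_of_generators ::
  "'a set \<Rightarrow> ('a \<Rightarrow> 'a) \<Rightarrow> ('g, 'b) monoid_scheme \<Rightarrow> ('a list \<Rightarrow> 'g) \<Rightarrow> bool" where
  "choice_of_generators Sig iv G pi \<longleftrightarrow>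
     group G \<and> finite Sig \<and>
     (\<forall>a \<in> Sig. iv a \<in> Sig \<and> iv (iv a) = a \<and> iv a \<noteq> a) \<and>
     (\<forall>w \<in> lists Sig. pi w \<in> carrier G) \<and>
     pi [] = \<one>\<^bsub>G\<^esub> \<and>
     (\<forall>u \<in> lists Sig. \<forall>v \<in> lists Sig. pi (u @ v) = pi u \<otimes>\<^bsub>G\<^esub> pi v) \<and>
     pi ` lists Sig = carrier G \<and>
     (\<forall>w \<in> lists Sig. pi (word_inv iv w) = inv\<^bsub>G\<^esub> (pi w))"

definition combing :: "'a set \<Rightarrow> ('g, 'b) monoid_scheme \<Rightarrow> ('a list \<Rightarrow> 'g) \<Rightarrow> 'a list set \<Rightarrow> bool" where
  "combing Sig G pi R \<longleftrightarrow> R \<subseteq> lists Sig \<and> pi ` R = carrier G"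

definition Sigma_eps :: "'a set \<Rightarrow> 'a list set" where
  "Sigma_eps Sig = insert [] {[a] | a. a \<in> Sig}"

definition C_lang ::
  "('g, 'b) monoid_scheme \<Rightarrow> ('a list \<Rightarrow> 'g) \<Rightarrow> 'a \<Rightarrow> 'a list set \<Rightarrow> 'g \<Rightarrow> 'a list set" where
  "C_lang G pi hash R g =
     {u @ [hash] @ w | u w. u \<in> R \<and> w \<in> R \<and> pi u \<otimes>\<^bsub>G\<^esub> g \<otimes>\<^bsub>G\<^esub> pi w = \<one>\<^bsub>G\<^esub>}"

definition async_automatic_wrt ::
  "'a set \<Rightarrow> ('g, 'b) monoid_scheme \<Rightarrow> ('a list \<Rightarrow> 'g) \<Rightarrow> 'a list set \<Rightarrow> bool" where
  "async_automatic_wrt Sig G pi R' \<longleftrightarrow>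
     combing Sig G pi R' \<and> regular_lang Sig R' \<and>
     (\<forall>a \<in> Sigma_eps Sig.
        rational_transduction Sig
          {(u, w). u \<in> R' \<and> w \<in> R' \<and> pi u \<otimes>\<^bsub>G\<^esub> pi a = pi w})"

end

theory Submission
  imports Defs
begin

text \<open>If the languages \<open>C(a)\<close> are context-free, follow the branch of a derivation tree of \<open>u#w\<close>
  that ends in \<open>#\<close>. All words derived from a nonterminal off this branch (on one side of \<open>#\<close>) have
  the same value in the group, so a long subword hanging off the branch contains a subword of
  moderate length that may be exchanged for a shorter one without leaving \<open>C(a)\<close>, hence without
  leaving \<open>R\<close>. Shortest representatives in \<open>R\<close> admit no such exchange: the words with derivations
  in which all pieces off the branch are short form a regular combing \<open>R1 \<subseteq> R\<close>. Deleting from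
  \<open>R1\<close> all words with a moderate factor that can be exchanged for a shorter one of the same value
  and the same syntactic class (with respect to \<open>R1\<close>) leaves a regular combing \<open>X\<close>, and now every \<open>u#w \<in> C(a)\<close> with \<open>u, w \<in> X\<close> has only short
  pieces off the branch; reading these pieces along the branch is a rational transduction between
  \<open>X\<close> and its formal inverse \<open>Y\<close>. The combing is \<open>X \<union> Y\<close>; the relations within \<open>X\<close> and
  within \<open>Y\<close> arise by composing transductions between \<open>X\<close> and \<open>Y\<close>.

  Conversely, an automaton for the transduction is a linear grammar for \<open>C(a)\<close> that writes its
  second tape, inverted, to the right of \<open>#\<close>.\<close>

section \<open>Rational subsets and finite automata\<close>

abbreviation set_mult :: "('m \<Rightarrow> 'm \<Rightarrow> 'm) \<Rightarrow> 'm set \<Rightarrow> 'm set \<Rightarrow> 'm set" where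
  "set_mult f A B \<equiv> {f x y | x y. x \<in> A \<and> y \<in> B}"

text \<open>The multiplication is a monoid on the whole type, and \<open>M\<close> is a submonoid of
  it. Words and pairs of words over a given alphabet then share one theory of rational
  subsets.\<close>

locale closed_monoid = Groups.monoid f e
  for f :: "'m \<Rightarrow> 'm \<Rightarrow> 'm" (infixl "\<cdot>" 70) and e :: 'm +
  fixes M :: "'m set"
  assumes unit_mem: "e \<in> M"
    and mult_mem: "x \<in> M \<Longrightarrow> y \<in> M \<Longrightarrow> x \<cdot> y \<in> M"
begin

abbreviation "rational \<equiv> rational_subsets f e M"

abbreviation star :: "'m set \<Rightarrow> 'm set" where
  "star \<equiv> submonoid_gen f e"

lemma star_mult: "x \<in> star A \<Longrightarrow> y \<in> star A \<Longrightarrow> x \<cdot> y \<in> star A"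
  by (induction rule: submonoid_gen.induct) (auto simp: assoc intro: submonoid_gen.intros)

lemma star_base: "x \<in> A \<Longrightarrow> x \<in> star A"
  using sg_step[of x A e f e] by (simp add: sg_unit)

lemma star_subset: "A \<subseteq> M \<Longrightarrow> star A \<subseteq> M"
proof
  fix x assume "A \<subseteq> M" "x \<in> star A"
  from this(2,1) show "x \<in> M"
    by (induction rule: submonoid_gen.induct) (auto intro: unit_mem mult_mem)
qed

lemma rational_subset: "A \<in> rational \<Longrightarrow> A \<subseteq> M"
proof (induction rule: rational_subsets.induct)
  case (rs_star A)
  show ?case using rs_star.IH by (rule star_subset)
qed (auto intro: mult_mem)

lemma rational_UN:
  "finite I \<Longrightarrow> (\<And>i. i \<in> I \<Longrightarrow> A i \<in> rational) \<Longrightarrow> (\<Union>i\<in>I. A i) \<in> rational"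
  by (induction rule: finite_induct) (auto intro: rs_union rs_finite)

section \<open>Kleene's theorem: from automata to rational subsets\<close>

inductive path :: "('s \<times> 'm \<times> 's) set \<Rightarrow> 's \<Rightarrow> 'm \<Rightarrow> 's \<Rightarrow> bool" for E where
  path_refl: "path E p e p"
| path_step: "(p, x, r) \<in> E \<Longrightarrow> path E r m q \<Longrightarrow> path E p (x \<cdot> m) q"

lemma path_edge: "(p, x, q) \<in> E \<Longrightarrow> path E p x q"
  using path_step[OF _ path_refl, of p x q E] by simp

lemma path_trans: "path E p x q \<Longrightarrow> path E q y r \<Longrightarrow> path E p (x \<cdot> y) r"
  by (induction rule: path.induct) (auto simp: assoc intro: path.intros)

lemma path_mono: "path E p x q \<Longrightarrow> E \<subseteq> E' \<Longrightarrow> path E' p x q"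
  by (induction rule: path.induct) (auto intro: path.intros)

text \<open>Kleene's construction, adding one edge at a time. A path that uses the new edge reaches
  \<open>a\<close>, runs through loops that each start with this edge and return to
  \<open>a\<close>, and goes from \<open>b\<close> to \<open>q\<close> after its last use of the
  edge.\<close>

lemma paths_insert_edge:
  fixes E :: "('s \<times> 'm \<times> 's) set"
  defines "R \<equiv> \<lambda>p q. {m. path E p m q}"
  shows "{m. path (insert (a, x, b) E) p m q} =
    R p q \<union> set_mult f (R p a)
      (set_mult f (star (set_mult f {x} (R b a))) (set_mult f {x} (R b q)))"
    (is "_ = ?N p q")
proof -
  let ?E = "insert (a, x, b) E" and ?S = "star (set_mult f {x} (R b a))"
  have "m \<in> ?N p q" if "path ?E p m q" for m p q
    using that
  proof (induction rule: path.induct)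
    case (path_refl p)
    then show ?case by (simp add: R_def path.path_refl)
  next
    case (path_step p y r m q)
    show ?case
    proof (cases "(p, y, r) \<in> E")
      case True
      then have step: "y \<cdot> k \<in> R p t" if "k \<in> R r t" for k t
        using that by (simp add: R_def path.path_step)
      from path_step.IH show ?thesis
      proof
        assume "m \<in> R r q"
        then show ?thesis using step by blast
      next
        assume "m \<in> set_mult f (R r a) (set_mult f ?S (set_mult f {x} (R b q)))"
        then obtain k n where m: "m = k \<cdot> n" and k: "k \<in> R r a"
          and n: "n \<in> set_mult f ?S (set_mult f {x} (R b q))"
          by blast
        have "y \<cdot> m = (y \<cdot> k) \<cdot> n" by (simp add: m assoc)
        then show ?thesis using step[OF k] n by blast
      qed
    next
      case False
      with path_step.hyps have eq: "p = a" "y = x" "r = b" by auto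
      have e: "e \<in> R a a" "e \<in> ?S" by (simp_all add: R_def path.path_refl sg_unit)
      from path_step.IH show ?thesis unfolding eq
      proof
        assume "m \<in> R b q"
        moreover have "x \<cdot> m = e \<cdot> (e \<cdot> (x \<cdot> m))" by simp
        ultimately show "x \<cdot> m \<in> ?N a q" using e by blast
      next
        assume "m \<in> set_mult f (R b a) (set_mult f ?S (set_mult f {x} (R b q)))"
        then obtain k s l where m: "m = k \<cdot> (s \<cdot> l)" and k: "k \<in> R b a" and s: "s \<in> ?S"
          and l: "l \<in> set_mult f {x} (R b q)"
          by blast
        have "x \<cdot> k \<in> set_mult f {x} (R b a)" using k by blast
        then have "x \<cdot> k \<cdot> s \<in> ?S" using s by (rule sg_step)
        moreover have "x \<cdot> m = e \<cdot> ((x \<cdot> k \<cdot> s) \<cdot> l)" by (simp add: m assoc)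
        ultimately show "x \<cdot> m \<in> ?N a q" using e l by blast
      qed
    qed
  qed
  moreover have "path ?E p m q" if "m \<in> ?N p q" for m
  proof -
    have old: "path ?E p m q" if "m \<in> R p q" for p q m
      using that path_mono[of E p m q ?E] by (auto simp: R_def)
    have x: "path ?E a x b" by (rule path_edge) simp
    have loop: "path ?E a s a" if "s \<in> ?S" for s
      using that
    proof (induction rule: submonoid_gen.induct)
      case sg_unit
      show ?case by (rule path_refl)
    next
      case (sg_step y s)
      then obtain k where "y = x \<cdot> k" "k \<in> R b a" by blast
      then have "path ?E a y a" using path_trans[OF x old] by blast
      then show ?case using sg_step.IH by (rule path_trans)
    qed
    from that show ?thesis
    proof
      assume "m \<in> R p q" then show ?thesis by (rule old)
    next
      assume "m \<in> set_mult f (R p a) (set_mult f ?S (set_mult f {x} (R b q)))"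
      then obtain k s l where "m = k \<cdot> (s \<cdot> (x \<cdot> l))" "k \<in> R p a" "s \<in> ?S" "l \<in> R b q"
        by blast
      then show ?thesis using path_trans[OF old path_trans[OF loop path_trans[OF x old]]] by blast
    qed
  qed
  ultimately show ?thesis by blast
qed

lemma rational_paths:
  assumes "finite E" "\<And>p x q. (p, x, q) \<in> E \<Longrightarrow> x \<in> M"
  shows "{m. path E p m q} \<in> rational"
  using assms
proof (induction arbitrary: p q rule: finite_induct)
  case empty
  have "{m. path {} p m q} = (if p = q then {e} else {})"
    by (auto elim: path.cases intro: path_refl)
  then show ?case by (auto intro: rs_finite unit_mem)
next
  case (insert d E)
  obtain a x b where d: "d = (a, x, b)" by (cases d)
  have "{x} \<in> rational" using insert.prems d by (auto intro: rs_finite)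
  moreover have "{m. path E p m q} \<in> rational" for p q
    using insert.prems by (intro insert.IH) blast
  ultimately show ?case unfolding d paths_insert_edge
    by (intro rs_union rs_prod rs_star)
qed

lemma rational_accepted:
  assumes "finite E" "\<And>p x q. (p, x, q) \<in> E \<Longrightarrow> x \<in> M" "finite I" "finite F"
  shows "{m. \<exists>p\<in>I. \<exists>q\<in>F. path E p m q} \<in> rational"
proof -
  have "{m. \<exists>p\<in>I. \<exists>q\<in>F. path E p m q} = (\<Union>p\<in>I. \<Union>q\<in>F. {m. path E p m q})" by auto
  then show ?thesis using assms by (auto intro!: rational_UN rational_paths)
qed

section \<open>Kleene's theorem: from rational subsets to automata\<close>

definition rename_states :: "('s \<Rightarrow> 't) \<Rightarrow> ('s \<times> 'm \<times> 's) set \<Rightarrow> ('t \<times> 'm \<times> 't) set" where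
  "rename_states g E = (\<lambda>(p, x, q). (g p, x, g q)) ` E"

lemma rename_states_iff:
  "(a, x, b) \<in> rename_states g E \<longleftrightarrow> (\<exists>p q. a = g p \<and> b = g q \<and> (p, x, q) \<in> E)"
  by (force simp: rename_states_def)

lemma finite_rename_states: "finite E \<Longrightarrow> finite (rename_states g E)"
  by (simp add: rename_states_def)

text \<open>States are natural numbers because a type of states cannot be quantified inside a
  definition. Labels are generators or the unit, so that later constructions can treat words letter
  by letter.\<close>

definition accepted_by_automaton :: "'m set \<Rightarrow> 'm set \<Rightarrow> bool" where
  "accepted_by_automaton \<Gamma> A \<longleftrightarrow> (\<exists>(E :: (nat \<times> 'm \<times> nat) set) I F.
     finite E \<and> finite I \<and> finite F \<and> (\<forall>(p, x, q) \<in> E. x \<in> insert e \<Gamma>) \<and>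
     A = {m. \<exists>p\<in>I. \<exists>q\<in>F. path E p m q})"

lemma accepted_by_automatonI:
  fixes E :: "(nat \<times> 'm \<times> nat) set"
  assumes "finite E" "finite I" "finite F" "\<forall>(p, x, q) \<in> E. x \<in> insert e \<Gamma>"
    "A = {m. \<exists>p\<in>I. \<exists>q\<in>F. path E p m q}"
  shows "accepted_by_automaton \<Gamma> A"
  unfolding accepted_by_automaton_def using assms by (intro exI conjI)

lemma accepted_by_automatonE:
  assumes "accepted_by_automaton \<Gamma> A"
  obtains E :: "(nat \<times> 'm \<times> nat) set" and I F
  where "finite E" "finite I" "finite F" "\<forall>(p, x, q) \<in> E. x \<in> insert e \<Gamma>"
    "A = {m. \<exists>p\<in>I. \<exists>q\<in>F. path E p m q}"
  using assms unfolding accepted_by_automaton_def by (elim exE conjE)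

text \<open>\<open>E'\<close> may have further edges, but those that leave a state in the image of
  \<open>g\<close> are exactly the copies of edges of \<open>E\<close>. So a path that starts in the
  copy stays in it.\<close>

lemma path_rename:
  assumes "inj g"
    and edges: "\<And>p x q. (g p, x, q) \<in> E' \<longleftrightarrow> (\<exists>q'. q = g q' \<and> (p, x, q') \<in> E)"
  shows "path E' (g p) m q \<longleftrightarrow> (\<exists>q'. q = g q' \<and> path E p m q')"
proof
  have "path E' s m q \<Longrightarrow> s = g p \<Longrightarrow> \<exists>q'. q = g q' \<and> path E p m q'" for s p m
  proof (induction arbitrary: p rule: path.induct)
    case (path_step s x r m q)
    then show ?case using edges by (metis path.path_step)
  qed (auto intro: path_refl)
  then show "path E' (g p) m q \<Longrightarrow> \<exists>q'. q = g q' \<and> path E p m q'" by blast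
next
  have "path E p m q' \<Longrightarrow> path E' (g p) m (g q')" for q'
  proof (induction rule: path.induct)
    case (path_step s x r m q)
    then show ?case using edges by (metis path.path_step)
  qed (auto intro: path_refl)
  then show "\<exists>q'. q = g q' \<and> path E p m q' \<Longrightarrow> path E' (g p) m q" by blast
qed

lemma accepted_singleton:
  assumes "x \<in> insert e \<Gamma>"
  shows "accepted_by_automaton \<Gamma> {x}"
proof -
  have "path {(0::nat, x, 1)} 0 m 1 \<longleftrightarrow> m = x" for m
    by (auto elim!: path.cases[of _ 0 m] path.cases[of _ "Suc 0"] intro: path_edge)
  then have "{x} = {m. \<exists>p\<in>{0}. \<exists>q\<in>{1}. path {(0::nat, x, 1)} p m q}" by auto
  moreover have "finite {(0::nat, x, 1::nat)}" "\<forall>(p, y, q)\<in>{(0::nat, x, 1::nat)}. y \<in> insert e \<Gamma>"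
    "finite {0::nat}" "finite {1::nat}"
    using assms by auto
  ultimately show ?thesis by (intro accepted_by_automatonI)
qed

lemma accepted_empty: "accepted_by_automaton \<Gamma> {}"
  by (rule accepted_by_automatonI[of "{}" "{}" "{}"]) simp_all

text \<open>States of the two automata are kept apart by sending them to the even and odd numbers.\<close>

lemma accepted_union:
  assumes "accepted_by_automaton \<Gamma> A" "accepted_by_automaton \<Gamma> B"
  shows "accepted_by_automaton \<Gamma> (A \<union> B)"
proof -
  obtain E :: "(nat \<times> 'm \<times> nat) set" and I F where 1: "finite E" "finite I" "finite F" "\<forall>(p, x, q) \<in> E. x \<in> insert e \<Gamma>"
    "A = {m. \<exists>p\<in>I. \<exists>q\<in>F. path E p m q}"
    by (rule accepted_by_automatonE[OF assms(1)])
  obtain E' :: "(nat \<times> 'm \<times> nat) set" and I' F' where 2: "finite E'" "finite I'" "finite F'" "\<forall>(p, x, q) \<in> E'. x \<in> insert e \<Gamma>"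
    "B = {m. \<exists>p\<in>I'. \<exists>q\<in>F'. path E' p m q}"
    by (rule accepted_by_automatonE[OF assms(2)])
  define g g' :: "nat \<Rightarrow> nat" where "g = (\<lambda>n. 2 * n)" and "g' = (\<lambda>n. Suc (2 * n))"
  have g: "inj g" "inj g'" "\<And>n k. g n \<noteq> g' k" "\<And>n k. g' n \<noteq> g k"
    unfolding g_def g'_def inj_def by (auto simp: double_not_eq_Suc_double Suc_double_not_eq_double)
  define D where "D = rename_states g E \<union> rename_states g' E'"
  have "path D (g p) m q \<longleftrightarrow> (\<exists>q'. q = g q' \<and> path E p m q')" for p m q
    by (rule path_rename) (use g in \<open>auto simp: D_def rename_states_iff inj_eq\<close>)
  moreover have "path D (g' p) m q \<longleftrightarrow> (\<exists>q'. q = g' q' \<and> path E' p m q')" for p m q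
    by (rule path_rename) (use g in \<open>auto simp: D_def rename_states_iff inj_eq\<close>)
  ultimately have "A \<union> B = {m. \<exists>p\<in>g ` I \<union> g' ` I'. \<exists>q\<in>g ` F \<union> g' ` F'. path D p m q}"
    using g by (auto simp: 1 2 bex_Un inj_eq)
  moreover have "finite D" "\<forall>(p, x, q) \<in> D. x \<in> insert e \<Gamma>" "finite (g ` I \<union> g' ` I')"
    "finite (g ` F \<union> g' ` F')"
    using 1 2 by (auto simp: D_def rename_states_iff finite_rename_states)
  ultimately show ?thesis by (intro accepted_by_automatonI)
qed

lemma accepted_mult:
  assumes "accepted_by_automaton \<Gamma> A" "accepted_by_automaton \<Gamma> B"
  shows "accepted_by_automaton \<Gamma> (set_mult f A B)"
proof -
  obtain E :: "(nat \<times> 'm \<times> nat) set" and I F where 1: "finite E" "finite I" "finite F" "\<forall>(p, x, q) \<in> E. x \<in> insert e \<Gamma>"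
    "A = {m. \<exists>p\<in>I. \<exists>q\<in>F. path E p m q}"
    by (rule accepted_by_automatonE[OF assms(1)])
  obtain E' :: "(nat \<times> 'm \<times> nat) set" and I' F' where 2: "finite E'" "finite I'" "finite F'" "\<forall>(p, x, q) \<in> E'. x \<in> insert e \<Gamma>"
    "B = {m. \<exists>p\<in>I'. \<exists>q\<in>F'. path E' p m q}"
    by (rule accepted_by_automatonE[OF assms(2)])
  define g g' :: "nat \<Rightarrow> nat" where "g = (\<lambda>n. 2 * n)" and "g' = (\<lambda>n. Suc (2 * n))"
  have g: "inj g" "inj g'" "\<And>n k. g n \<noteq> g' k" "\<And>n k. g' n \<noteq> g k"
    unfolding g_def g'_def inj_def by (auto simp: double_not_eq_Suc_double Suc_double_not_eq_double)
  define D where "D = rename_states g E \<union> rename_states g' E'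
    \<union> (\<lambda>(p, q). (g p, e, g' q)) ` (F \<times> I')"
  \<comment> \<open>The bridges lead from the first copy to the second and never back. So the second
    copy satisfies \<open>path_rename\<close>, while a path from the first copy to the second has to
    be cut at its bridge (\<open>split\<close>).\<close>
  have right: "path D (g' p) m q \<longleftrightarrow> (\<exists>q'. q = g' q' \<and> path E' p m q')" for p m q
    by (rule path_rename) (use g in \<open>auto simp: D_def rename_states_iff inj_eq\<close>)
  have left: "path D (g p) m (g q)" if "path E p m q" for p m q
    using that
  proof (induction rule: path.induct)
    case (path_step p x r m q)
    then have "(g p, x, g r) \<in> D" by (auto simp: D_def rename_states_iff)
    then show ?case using path_step.IH by (rule path.path_step)
  qed (rule path_refl)
  have split: "\<exists>k l. \<exists>t\<in>F. \<exists>r\<in>I'. path E p k t \<and> path E' r l q \<and> m = k \<cdot> l"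
    if "path D s m t" "s = g p" "t = g' q" for s m t p q
    using that
  proof (induction arbitrary: p q rule: path.induct)
    case (path_refl s)
    then show ?case using g by auto
  next
    case (path_step s x r m t)
    from path_step.hyps(1) path_step.prems(1)
    consider r' where "r = g r'" "(p, x, r') \<in> E" | r' where "r = g' r'" "p \<in> F" "r' \<in> I'" "x = e"
      using g by (auto simp: D_def rename_states_iff inj_eq)
    then show ?case
    proof cases
      case 1
      with path_step.IH[of r' q] path_step.prems obtain k l t' r1 where
        *: "t' \<in> F" "r1 \<in> I'" "path E r' k t'" "path E' r1 l q" "m = k \<cdot> l" by blast
      have "path E p (x \<cdot> k) t'" using 1(2) *(3) by (rule path.path_step)
      moreover have "x \<cdot> m = x \<cdot> k \<cdot> l" by (simp add: *(5) assoc)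
      ultimately show ?thesis using * by blast
    next
      case 2
      then have "path E' r' m q" using path_step.hyps(2) path_step.prems right g by (auto simp: inj_eq)
      moreover have "path E p e p" by (rule path.path_refl)
      moreover have "x \<cdot> m = e \<cdot> m" by (simp add: 2)
      ultimately show ?thesis using 2(2,3) by blast
    qed
  qed
  have join: "path D (g p) (k \<cdot> l) (g' q)"
    if "path E p k t" "t \<in> F" "r \<in> I'" "path E' r l q" for p k t r l q
  proof -
    have "(g t, e, g' r) \<in> D" using that by (auto simp: D_def rename_states_iff)
    then have "path D (g t) e (g' r)" by (rule path_edge)
    moreover have "path D (g' r) l (g' q)" using right that(4) by blast
    ultimately have "path D (g p) (k \<cdot> (e \<cdot> l)) (g' q)"
      by (intro path_trans[OF left[OF that(1)]] path_trans)
    then show ?thesis by simp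
  qed
  have "set_mult f A B = {m. \<exists>p\<in>g ` I. \<exists>q\<in>g' ` F'. path D p m q}"
  proof (intro subset_antisym subsetI)
    fix m assume "m \<in> set_mult f A B"
    then obtain k l where m: "m = k \<cdot> l" and kl: "k \<in> A" "l \<in> B" by blast
    obtain p t where pt: "p \<in> I" "t \<in> F" "path E p k t" using kl(1) 1(5) by blast
    obtain r q where rq: "r \<in> I'" "q \<in> F'" "path E' r l q" using kl(2) 2(5) by blast
    have "path D (g p) m (g' q)" unfolding m using pt(3,2) rq(1,3) by (rule join)
    then show "m \<in> {m. \<exists>p\<in>g ` I. \<exists>q\<in>g' ` F'. path D p m q}"
      using pt rq by blast
  next
    fix m assume "m \<in> {m. \<exists>p\<in>g ` I. \<exists>q\<in>g' ` F'. path D p m q}"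
    then obtain p q where "p \<in> I" "q \<in> F'" "path D (g p) m (g' q)" by blast
    moreover from split[OF this(3) refl refl] obtain k l t r where
      "t \<in> F" "r \<in> I'" "path E p k t" "path E' r l q" "m = k \<cdot> l" by blast
    ultimately have "k \<in> A" "l \<in> B" using 1(5) 2(5) by blast+
    then show "m \<in> set_mult f A B" using \<open>m = k \<cdot> l\<close> by blast
  qed
  moreover have "finite D" "\<forall>(p, x, q) \<in> D. x \<in> insert e \<Gamma>" "finite (g ` I)" "finite (g' ` F')"
    using 1 2 by (auto simp: D_def rename_states_iff finite_rename_states)
  ultimately show ?thesis by (intro accepted_by_automatonI)
qed

lemma accepted_star:
  assumes "accepted_by_automaton \<Gamma> A"
  shows "accepted_by_automaton \<Gamma> (star A)"
proof -
  obtain E :: "(nat \<times> 'm \<times> nat) set" and I F where 1: "finite E" "finite I" "finite F" "\<forall>(p, x, q) \<in> E. x \<in> insert e \<Gamma>"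
    "A = {m. \<exists>p\<in>I. \<exists>q\<in>F. path E p m q}"
    by (rule accepted_by_automatonE[OF assms(1)])
  \<comment> \<open>State 0 is a hub, initial and final at once; \<open>Suc\<close> makes room for
    it. Unit edges lead from the hub to the old initial states and from the old final states
    back.\<close>
  define D where "D = rename_states Suc E \<union> (\<lambda>p. (0, e, Suc p)) ` I
    \<union> (\<lambda>q. (Suc q, e, 0)) ` F"
  have inner: "path D (Suc p) m (Suc q)" if "path E p m q" for p m q
    using that
  proof (induction rule: path.induct)
    case (path_step p x r m q)
    then have "(Suc p, x, Suc r) \<in> D" by (auto simp: D_def rename_states_iff)
    then show ?case using path_step.IH by (rule path.path_step)
  qed (rule path_refl)
  have "path D 0 m 0" if "m \<in> star A" for m
    using that
  proof (induction rule: submonoid_gen.induct)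
    case (sg_step x m)
    then obtain p q where pq: "p \<in> I" "q \<in> F" "path E p x q" by (auto simp: 1)
    then have "path D 0 e (Suc p)" "path D (Suc q) e 0"
      by (auto intro!: path_edge simp: D_def rename_states_iff)
    then have "path D 0 (e \<cdot> (x \<cdot> (e \<cdot> m))) 0"
      using inner[OF pq(3)] sg_step.IH by (blast intro: path_trans)
    then show ?case by simp
  qed (rule path_refl)
  \<comment> \<open>The claim has to cover paths that start in the middle of a run: such a path
    first completes the run to a final state, and the rest, from the hub on, spells an element of
    the star.\<close>
  moreover have
    "(s = 0 \<longrightarrow> m \<in> star A) \<and>
     (\<forall>p. s = Suc p \<longrightarrow> (\<exists>k l. \<exists>q\<in>F. path E p k q \<and> l \<in> star A \<and> m = k \<cdot> l))"
    if "path D s m t" "t = 0" for s m t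
    using that
  proof (induction rule: path.induct)
    case (path_refl s)
    then show ?case by (simp add: sg_unit)
  next
    case (path_step s x r m t)
    from path_step.hyps(1)
    consider p where "s = 0" "x = e" "p \<in> I" "r = Suc p"
      | p q where "s = Suc p" "r = Suc q" "(p, x, q) \<in> E"
      | q where "s = Suc q" "r = 0" "x = e" "q \<in> F"
      by (auto simp: D_def rename_states_iff)
    then show ?case
    proof cases
      case 1
      with path_step.IH path_step.prems obtain k l q where
        "q \<in> F" "path E p k q" "l \<in> star A" "m = k \<cdot> l" by blast
      moreover from this have "k \<in> A" using 1 \<open>A = _\<close> by blast
      ultimately show ?thesis using 1 by (simp add: sg_step)
    next
      case 2
      with path_step.IH path_step.prems obtain k l q' where
        *: "q' \<in> F" "path E q k q'" "l \<in> star A" "m = k \<cdot> l" by blast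
      have "path E p (x \<cdot> k) q'" using 2(3) *(2) by (rule path.path_step)
      moreover have "x \<cdot> m = x \<cdot> k \<cdot> l" by (simp add: *(4) assoc)
      ultimately show ?thesis using * 2 by blast
    next
      case 3
      with path_step.IH path_step.prems have "m \<in> star A" by blast
      moreover have "path E q e q" by (rule path.path_refl)
      ultimately show ?thesis using 3 by force
    qed
  qed
  ultimately have "star A = {m. \<exists>p\<in>{0}. \<exists>q\<in>{0}. path D p m q}" by auto
  moreover have "finite D" "\<forall>(p, x, q) \<in> D. x \<in> insert e \<Gamma>" "finite {0::nat}"
    using 1 by (auto simp: D_def rename_states_iff finite_rename_states)
  ultimately show ?thesis by (intro accepted_by_automatonI)
qed

text \<open>Union, product and star are covered by the constructions above. In a finite set each
  element is a product of generators, since \<open>M\<close> lies in the submonoid generated by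
  \<Gamma>, and is read one generator per edge.\<close>

lemma rational_accepted_by_automaton:
  assumes gen: "M \<subseteq> star \<Gamma>" and "A \<in> rational"
  shows "accepted_by_automaton \<Gamma> A"
  using assms(2)
proof (induction rule: rational_subsets.induct)
  case (rs_finite A)
  have single: "accepted_by_automaton \<Gamma> {x}" if "x \<in> star \<Gamma>" for x
    using that
  proof (induction rule: submonoid_gen.induct)
    case sg_unit
    show ?case by (rule accepted_singleton) simp
  next
    case (sg_step x y)
    have "accepted_by_automaton \<Gamma> (set_mult f {x} {y})"
      using sg_step.hyps(1) sg_step.IH
      by (intro accepted_mult) (simp_all add: accepted_singleton)
    then show ?case by simp
  qed
  from rs_finite show ?case
  proof (induction rule: finite_induct)
    case empty
    show ?case by (rule accepted_empty)
  next
    case (insert x A)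
    then have "accepted_by_automaton \<Gamma> ({x} \<union> A)"
      using gen by (intro accepted_union single) auto
    then show ?case by simp
  qed
next
  case (rs_union A B)
  show ?case using rs_union.IH by (rule accepted_union)
next
  case (rs_prod A B)
  show ?case using rs_prod.IH by (rule accepted_mult)
next
  case (rs_star A)
  show ?case using rs_star.IH by (rule accepted_star)
qed

end

text \<open>Needed for the swap of the two tapes (converse relations) and for the projection to the
  first tape (domains).\<close>

lemma rational_hom:
  assumes "A \<in> rational_subsets f e M"
    and hom: "\<And>x y. h (f x y) = f' (h x) (h y)" "h e = e'" "h ` M \<subseteq> M'"
  shows "h ` A \<in> rational_subsets f' e' M'"
  using assms(1)
proof (induction rule: rational_subsets.induct)
  case (rs_finite A)
  then show ?case using hom(3) by (intro rational_subsets.rs_finite) auto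
next
  case (rs_union A B)
  then show ?case by (simp add: image_Un rational_subsets.rs_union)
next
  case (rs_prod A B)
  have "h ` set_mult f A B = set_mult f' (h ` A) (h ` B)"
  proof (intro subset_antisym subsetI)
    fix z assume "z \<in> h ` set_mult f A B"
    then obtain x y where "x \<in> A" "y \<in> B" "z = f' (h x) (h y)" using hom(1) by blast
    then show "z \<in> set_mult f' (h ` A) (h ` B)" by blast
  next
    fix z assume "z \<in> set_mult f' (h ` A) (h ` B)"
    then obtain x y where "x \<in> A" "y \<in> B" "z = h (f x y)" using hom(1) by force
    then show "z \<in> h ` set_mult f A B" by blast
  qed
  then show ?case using rs_prod by (simp add: rational_subsets.rs_prod)
next
  case (rs_star A)
  have "h x \<in> submonoid_gen f' e' (h ` A)" if "x \<in> submonoid_gen f e A" for x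
    using that
  proof (induction rule: submonoid_gen.induct)
    case sg_unit
    show ?case unfolding hom(2) by (rule submonoid_gen.sg_unit)
  next
    case (sg_step x y)
    then show ?case unfolding hom(1) by (intro submonoid_gen.sg_step imageI)
  qed
  moreover have "y \<in> h ` submonoid_gen f e A" if "y \<in> submonoid_gen f' e' (h ` A)" for y
    using that
  proof (induction rule: submonoid_gen.induct)
    case sg_unit
    show ?case using hom(2) submonoid_gen.sg_unit[of e f A] by (metis imageI)
  next
    case (sg_step x y)
    then obtain x' y' where "x = h x'" "x' \<in> A" "y = h y'" "y' \<in> submonoid_gen f e A" by blast
    then show ?case using hom(1)[of x' y'] submonoid_gen.sg_step[of x' A y' f e]
      by (metis imageI)
  qed
  ultimately have "h ` submonoid_gen f e A = submonoid_gen f' e' (h ` A)" by blast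
  then show ?case using rs_star by (simp add: rational_subsets.rs_star)
qed

section \<open>Regular languages and their residuals\<close>

interpretation words: closed_monoid "(@)" "[]" "lists S" for S
  by unfold_locales auto

text \<open>The left quotient of a language by a word. In the sense of Myhill and Nerode, a language
  over a finite alphabet is regular exactly if it has finitely many quotients.\<close>

definition residual :: "'a list set \<Rightarrow> 'a list \<Rightarrow> 'a list set" where
  "residual L u = {v. u @ v \<in> L}"

lemma in_residual_iff [simp]: "v \<in> residual L u \<longleftrightarrow> u @ v \<in> L"
  by (simp add: residual_def)

lemma residual_append: "residual L (u @ v) = residual (residual L u) v"
  by (auto simp: residual_def)

lemma residual_Cons: "residual L (a # v) = residual (residual L [a]) v"
  by (auto simp: residual_def)

lemma residual_Nil [simp]: "residual L [] = L"
  by (simp add: residual_def)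

text \<open>The pattern for counting quotients: each one is computed from data that take only
  finitely many values.\<close>

lemma finite_range_factor:
  assumes "finite (range g)" "\<And>u. f u = h (g u)"
  shows "finite (range f)"
proof -
  have "range f \<subseteq> h ` range g" using assms(2) by auto
  then show ?thesis using assms(1) by (rule finite_surj[rotated])
qed

lemma finite_range_Pair:
  assumes "finite (range f)" "finite (range g)"
  shows "finite (range (\<lambda>u. (f u, g u)))"
  by (rule finite_subset[of _ "range f \<times> range g"]) (use assms in auto)

lemma finite_range_subset_of:
  assumes "finite (range f)" "\<And>u. g u \<subseteq> range f"
  shows "finite (range g)"
  by (rule finite_subset[of _ "Pow (range f)"]) (use assms in auto)

lemma finite_residuals_regular:
  assumes "regular_lang S L"
  shows "finite (range (residual L))"
  using assms unfolding regular_lang_def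
proof (induction rule: rational_subsets.induct)
  case (rs_finite A)
  have "residual A u \<in> Pow (\<Union>w\<in>A. (\<lambda>n. drop n w) ` {..length w})" for u
  proof
    have "v \<in> (\<lambda>n. drop n (u @ v)) ` {..length (u @ v)}" for v
      by (rule image_eqI[of _ _ "length u"]) auto
    then show "residual A u \<subseteq> (\<Union>w\<in>A. (\<lambda>n. drop n w) ` {..length w})" by fastforce
  qed
  then have "range (residual A) \<subseteq> Pow (\<Union>w\<in>A. (\<lambda>n. drop n w) ` {..length w})" by blast
  then show ?case using rs_finite(1) by (elim finite_subset) auto
next
  case (rs_union A B)
  then have "finite (range (\<lambda>u. (residual A u, residual B u)))" by (intro finite_range_Pair)
  then show ?case
    by (rule finite_range_factor[where h = "\<lambda>(X, Y). X \<union> Y"]) (auto simp: residual_def)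
next
  case (rs_prod A B)
  \<comment> \<open>If \<open>u @ w\<close> lies in the product, the cut between the factors falls
    into \<open>w\<close>, or it splits \<open>u\<close> into a prefix in \<open>A\<close> and a
    suffix \<open>v\<close>. \<open>g u\<close> collects the quotients of \<open>B\<close> by these
    \<open>v\<close>; being a subset of a finite family, it takes finitely many values.\<close>
  define g where "g u = {residual B v | v. \<exists>u'. u = u' @ v \<and> u' \<in> A}" for u
  have "finite (range g)"
    by (rule finite_range_subset_of[OF rs_prod.IH(2)]) (auto simp: g_def)
  then have "finite (range (\<lambda>u. (residual A u, g u)))"
    using rs_prod.IH by (intro finite_range_Pair)
  then show ?case
  proof (rule finite_range_factor[where h = "\<lambda>(X, Y). set_mult (@) X B \<union> \<Union> Y"])
    fix u
    show "residual (set_mult (@) A B) u =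
      (case (residual A u, g u) of (X, Y) \<Rightarrow> set_mult (@) X B \<union> \<Union> Y)"
    proof (intro subset_antisym subsetI)
      fix w assume "w \<in> residual (set_mult (@) A B) u"
      then obtain x y where xy: "u @ w = x @ y" "x \<in> A" "y \<in> B" by auto
      then consider v where "u @ v \<in> A" "w = v @ y" | v where "u = x @ v" "v @ w \<in> B"
        by (auto simp: append_eq_append_conv2)
      then show "w \<in> (case (residual A u, g u) of (X, Y) \<Rightarrow> set_mult (@) X B \<union> \<Union> Y)"
      proof cases
        case 1
        then show ?thesis using xy by auto
      next
        case 2
        then have "residual B v \<in> g u" using xy by (auto simp: g_def)
        moreover have "w \<in> residual B v" using 2 by simp
        ultimately have "w \<in> \<Union> (g u)" by (rule UnionI)
        then show ?thesis by simp
      qed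
    next
      fix w assume "w \<in> (case (residual A u, g u) of (X, Y) \<Rightarrow> set_mult (@) X B \<union> \<Union> Y)"
      then consider x y where "u @ x \<in> A" "y \<in> B" "w = x @ y"
        | u' v where "u = u' @ v" "u' \<in> A" "v @ w \<in> B"
        by (auto simp: g_def)
      then have "\<exists>a b. u @ w = a @ b \<and> a \<in> A \<and> b \<in> B"
        by cases (metis append.assoc)+
      then show "w \<in> residual (set_mult (@) A B) u" by simp
    qed
  qed
next
  case (rs_star A)
  let ?S = "submonoid_gen (@) [] A"
  define g where "g u = {residual A v | v. \<exists>u'. u = u' @ v \<and> u' \<in> ?S}" for u
  \<comment> \<open>\<open>k u\<close> is \<open>{[]}\<close> or empty and accounts for the
    continuation \<open>[]\<close> when \<open>u\<close> itself lies in the star.\<close>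
  define k where "k u = {w :: 'a list. w = [] \<and> u \<in> ?S}" for u
  have "finite (range g)"
    by (rule finite_range_subset_of[OF rs_star.IH]) (auto simp: g_def)
  moreover have "finite (range k)"
    by (rule finite_subset[of _ "Pow {[]}"]) (auto simp: k_def)
  ultimately have "finite (range (\<lambda>u. (g u, k u)))" by (intro finite_range_Pair)
  then show ?case
  proof (rule finite_range_factor[where h = "\<lambda>(Y, Z). set_mult (@) (\<Union> Y) ?S \<union> Z"])
    fix u
    show "residual ?S u = (case (g u, k u) of (Y, Z) \<Rightarrow> set_mult (@) (\<Union> Y) ?S \<union> Z)"
    proof (intro subset_antisym subsetI)
      \<comment> \<open>Factors are peeled off the product until \<open>u\<close> is exhausted or
        some factor \<open>v @ x\<close> reaches the end of \<open>u\<close>.\<close>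
      have "(w = [] \<and> u \<in> ?S) \<or>
        (\<exists>u' v x y. u = u' @ v \<and> u' \<in> ?S \<and> w = x @ y \<and> v @ x \<in> A \<and> y \<in> ?S)"
        if "z \<in> ?S" "z = u @ w" for z u w
        using that
      proof (induction arbitrary: u rule: submonoid_gen.induct)
        case sg_unit
        then show ?case by (simp add: submonoid_gen.sg_unit)
      next
        case (sg_step x y)
        from sg_step.prems consider v where "x = u @ v" "w = v @ y" | v where "u = x @ v" "y = v @ w"
          by (auto simp: append_eq_append_conv2)
        then show ?case
        proof cases
          case 1
          then have "u = [] @ u" "[] \<in> ?S" "u @ v \<in> A"
            using sg_step.hyps by (simp_all add: submonoid_gen.sg_unit)
          then show ?thesis using 1 sg_step.hyps by blast
        next
          case 2
          from sg_step.IH[OF 2(2)] show ?thesis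
          proof (elim disjE exE conjE)
            assume "w = []" "v \<in> ?S"
            then show ?thesis using 2 sg_step.hyps(1) submonoid_gen.sg_step by metis
          next
            fix u' v' x' y' assume *: "v = u' @ v'" "u' \<in> ?S" "w = x' @ y'" "v' @ x' \<in> A" "y' \<in> ?S"
            have "x @ u' \<in> ?S" using sg_step.hyps(1) *(2) by (rule submonoid_gen.sg_step)
            moreover have "u = (x @ u') @ v'" using 2 * by simp
            ultimately show ?thesis using * by blast
          qed
        qed
      qed
      moreover fix w assume "w \<in> residual ?S u"
      ultimately consider "w = []" "u \<in> ?S"
        | u' v x y where "u = u' @ v" "u' \<in> ?S" "w = x @ y" "v @ x \<in> A" "y \<in> ?S"
        by (metis in_residual_iff)
      then show "w \<in> (case (g u, k u) of (Y, Z) \<Rightarrow> set_mult (@) (\<Union> Y) ?S \<union> Z)"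
      proof cases
        case 1
        then show ?thesis by (simp add: k_def)
      next
        case 2
        then have "residual A v \<in> g u" by (auto simp: g_def)
        moreover have "x \<in> residual A v" using 2 by simp
        ultimately have "x \<in> \<Union> (g u)" by (rule UnionI)
        then show ?thesis using 2 by auto
      qed
    next
      fix w assume "w \<in> (case (g u, k u) of (Y, Z) \<Rightarrow> set_mult (@) (\<Union> Y) ?S \<union> Z)"
      then consider "w = []" "u \<in> ?S"
        | u' v x y where "u = u' @ v" "u' \<in> ?S" "w = x @ y" "v @ x \<in> A" "y \<in> ?S"
        by (auto simp: g_def k_def)
      then show "w \<in> residual ?S u"
      proof cases
        case 2
        then have "u' @ ((v @ x) @ y) \<in> ?S"
          by (intro words.star_mult submonoid_gen.sg_step)
        then show ?thesis using 2 by simp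
      qed simp
    qed
  qed
qed

text \<open>The quotients are the states of a deterministic automaton that starts in
  \<open>L\<close> and accepts in the quotients containing the empty word. Its states are languages,
  so it relies on \<open>rational_accepted\<close> holding for every type of states.\<close>

lemma regular_finite_residuals:
  assumes "finite S" "L \<subseteq> lists S" "finite (range (residual L))"
  shows "regular_lang S L"
proof -
  let ?Q = "range (residual L)"
  define E where "E = (\<lambda>(K, a). (K, [a], residual K [a])) ` (?Q \<times> S)"
  have closed: "residual K w \<in> ?Q" if "K \<in> ?Q" for K w
    using that by (auto simp flip: residual_append)
  have "words.path E K w K' \<longleftrightarrow> w \<in> lists S \<and> K' = residual K w" if "K \<in> ?Q" for K w K'
  proof
    show "w \<in> lists S \<and> K' = residual K w" if "words.path E K w K'"
      using that
    proof (induction rule: words.path.induct)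
      case (path_step p x r m q)
      then obtain a where "x = [a]" "a \<in> S" "r = residual p [a]" by (auto simp: E_def)
      then show ?case using path_step.IH by (simp add: residual_Cons[of p a m])
    qed simp
    show "words.path E K w K'" if "w \<in> lists S \<and> K' = residual K w"
      using that \<open>K \<in> ?Q\<close>
    proof (induction w arbitrary: K)
      case Nil
      then show ?case by (simp add: words.path_refl)
    next
      case (Cons a w)
      have "(K, [a], residual K [a]) \<in> E" using Cons.prems by (auto simp: E_def)
      moreover have "words.path E (residual K [a]) w K'"
        using Cons closed by (simp add: residual_Cons[of K a w])
      ultimately show ?case using words.path_step by fastforce
    qed
  qed
  moreover have "L \<in> ?Q" by (rule range_eqI[of _ _ "[]"]) simp
  ultimately have paths: "words.path E L w K' \<longleftrightarrow> w \<in> lists S \<and> K' = residual L w" for w K'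
    by blast
  have "L = {w. \<exists>p\<in>{L}. \<exists>q\<in>{K \<in> ?Q. [] \<in> K}. words.path E p w q}"
    using assms(2) by (auto simp: paths)
  also have "\<dots> \<in> rational_subsets (@) [] (lists S)"
    by (rule words.rational_accepted) (use assms in \<open>auto simp: E_def\<close>)
  finally show ?thesis by (simp add: regular_lang_def)
qed

lemma regular_subset: "regular_lang S L \<Longrightarrow> L \<subseteq> lists S"
  unfolding regular_lang_def by (rule words.rational_subset)

lemma regular_lists:
  assumes "finite S"
  shows "regular_lang S (lists S)"
proof (rule regular_finite_residuals)
  have "range (residual (lists S)) \<subseteq> {lists S, {}}" by (auto simp: residual_def)
  then show "finite (range (residual (lists S)))" by (rule finite_subset) simp
qed (use assms in auto)

lemma regular_Diff:
  assumes "finite S" "regular_lang S A" "regular_lang S B"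
  shows "regular_lang S (A - B)"
proof (rule regular_finite_residuals)
  have "finite (range (\<lambda>u. (residual A u, residual B u)))"
    using assms by (intro finite_range_Pair finite_residuals_regular)
  then show "finite (range (residual (A - B)))"
    by (rule finite_range_factor[where h = "\<lambda>(X, Y). X - Y"]) (auto simp: residual_def)
qed (use assms regular_subset in auto)

lemma regular_factors:
  assumes "finite S" "finite V" "V \<subseteq> lists S"
  shows "regular_lang S {p @ b @ q | p b q. p \<in> lists S \<and> b \<in> V \<and> q \<in> lists S}"
proof -
  have "{p @ b @ q | p b q. p \<in> lists S \<and> b \<in> V \<and> q \<in> lists S}
    = set_mult (@) (lists S) (set_mult (@) V (lists S))" by blast
  moreover have "V \<in> words.rational S" using assms(2,3) by (rule rs_finite)
  ultimately show ?thesis using regular_lists[OF assms(1)]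
    by (simp only: regular_lang_def) (intro rs_prod)
qed

text \<open>The set of contexts that complete \<open>w\<close> to a word of \<open>L\<close>. Words
  with equal sets are interchangeable as factors of words of \<open>L\<close>.\<close>

definition syntactic_class :: "'a list set \<Rightarrow> 'a list \<Rightarrow> ('a list \<times> 'a list) set" where
  "syntactic_class L w = {(x, y). x @ w @ y \<in> L}"

lemma syntactic_class_cong:
  "syntactic_class L w = syntactic_class L w' \<Longrightarrow> x @ w @ y \<in> L \<longleftrightarrow> x @ w' @ y \<in> L"
  by (auto simp: syntactic_class_def set_eq_iff)

text \<open>A word acts on the finitely many quotients by sending \<open>K\<close> to
  \<open>residual K w\<close>, so only finitely many actions exist. The action determines all
  contexts: \<open>x @ w @ y\<close> is in \<open>L\<close> iff \<open>y\<close> is in the image of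
  \<open>residual L x\<close>.\<close>

lemma finite_syntactic_classes:
  assumes "regular_lang S L"
  shows "finite (range (syntactic_class L))"
proof -
  let ?Q = "range (residual L)"
  define g where "g w = {(K, residual K w) | K. K \<in> ?Q}" for w
  have "range g \<subseteq> Pow (?Q \<times> ?Q)"
    by (auto simp: g_def simp flip: residual_append)
  then have "finite (range g)"
    by (rule finite_subset) (use finite_residuals_regular[OF assms] in auto)
  then show ?thesis
    by (rule finite_range_factor[where h = "\<lambda>D. {(x, y). \<exists>K. (residual L x, K) \<in> D \<and> y \<in> K}"])
      (auto simp: syntactic_class_def g_def)
qed

section \<open>Formal inversion of words and of regular languages\<close>

lemma word_inv_append: "word_inv iv (u @ v) = word_inv iv v @ word_inv iv u"
  by (simp add: word_inv_def)

lemma word_inv_Nil [simp]: "word_inv iv [] = []"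
  by (simp add: word_inv_def)

text \<open>Formal inversion reverses products, so \<open>rational_hom\<close> does not apply; its
  induction is repeated with the factors swapped.\<close>

lemma regular_word_inv:
  assumes "regular_lang S L" "\<And>a. a \<in> S \<Longrightarrow> iv a \<in> S"
  shows "regular_lang S (word_inv iv ` L)"
  using assms(1) unfolding regular_lang_def
proof (induction rule: rational_subsets.induct)
  case (rs_finite A)
  then show ?case using assms(2)
    by (intro rational_subsets.rs_finite) (force simp: word_inv_def)+
next
  case (rs_union A B)
  then show ?case by (simp add: image_Un rational_subsets.rs_union)
next
  case (rs_prod A B)
  have "word_inv iv ` set_mult (@) A B = set_mult (@) (word_inv iv ` B) (word_inv iv ` A)"
  proof (intro subset_antisym subsetI)
    fix z assume "z \<in> word_inv iv ` set_mult (@) A B"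
    then obtain x y where "x \<in> A" "y \<in> B" "z = word_inv iv y @ word_inv iv x"
      by (auto simp: word_inv_append)
    then show "z \<in> set_mult (@) (word_inv iv ` B) (word_inv iv ` A)" by blast
  next
    fix z assume "z \<in> set_mult (@) (word_inv iv ` B) (word_inv iv ` A)"
    then obtain x y where "x \<in> A" "y \<in> B" "z = word_inv iv (x @ y)"
      by (auto simp: word_inv_append)
    then show "z \<in> word_inv iv ` set_mult (@) A B" by blast
  qed
  then show ?case using rs_prod by (simp add: rational_subsets.rs_prod)
next
  case (rs_star A)
  let ?S = "submonoid_gen (@) []"
  have "word_inv iv x \<in> ?S (word_inv iv ` A)" if "x \<in> ?S A" for x
    using that
  proof (induction rule: submonoid_gen.induct)
    case sg_unit
    then show ?case by (simp add: submonoid_gen.sg_unit)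
  next
    case (sg_step x y)
    then show ?case unfolding word_inv_append
      using words.star_mult[OF sg_step.IH words.star_base] by blast
  qed
  moreover have "y \<in> word_inv iv ` ?S A" if "y \<in> ?S (word_inv iv ` A)" for y
    using that
  proof (induction rule: submonoid_gen.induct)
    case sg_unit
    then show ?case by (rule image_eqI[of _ _ "[]"]) (simp_all add: submonoid_gen.sg_unit)
  next
    case (sg_step x y)
    then obtain x' y' where "x = word_inv iv x'" "x' \<in> A" "y = word_inv iv y'" "y' \<in> ?S A"
      by blast
    then have "x @ y = word_inv iv (y' @ x')" "y' @ x' \<in> ?S A"
      by (auto simp: word_inv_append intro: words.star_mult words.star_base)
    then show ?case by blast
  qed
  ultimately have "word_inv iv ` ?S A = ?S (word_inv iv ` A)" by blast
  then show ?case using rs_star by (simp add: rational_subsets.rs_star)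
qed

section \<open>Rational transductions\<close>

abbreviation pair_append :: "'a list \<times> 'a list \<Rightarrow> 'a list \<times> 'a list \<Rightarrow> 'a list \<times> 'a list" where
  "pair_append \<equiv> \<lambda>(u1, v1) (u2, v2). (u1 @ u2, v1 @ v2)"

interpretation pairs: closed_monoid pair_append "([], [])" "lists S \<times> lists S" for S
  by unfold_locales auto

text \<open>With these labels and the unit, an edge of a transducer handles at most one letter on
  one of the two tapes.\<close>

definition letter_pairs :: "'a set \<Rightarrow> ('a list \<times> 'a list) set" where
  "letter_pairs S = (\<lambda>a. ([a], [])) ` S \<union> (\<lambda>a. ([], [a])) ` S"

lemma pairs_generated: "lists S \<times> lists S \<subseteq> pairs.star (letter_pairs S)"
proof -
  have "(u, []) \<in> pairs.star (letter_pairs S)" if "u \<in> lists S" for u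
    using that
  proof (induction u)
    case (Cons a u)
    then have "pair_append ([a], []) (u, []) \<in> pairs.star (letter_pairs S)"
      by (intro sg_step) (auto simp: letter_pairs_def)
    then show ?case by simp
  qed (simp add: sg_unit)
  moreover have "([], v) \<in> pairs.star (letter_pairs S)" if "v \<in> lists S" for v
    using that
  proof (induction v)
    case (Cons a v)
    then have "pair_append ([], [a]) ([], v) \<in> pairs.star (letter_pairs S)"
      by (intro sg_step) (auto simp: letter_pairs_def)
    then show ?case by simp
  qed (simp add: sg_unit)
  ultimately have "pair_append (u, []) ([], v) \<in> pairs.star (letter_pairs S)"
    if "u \<in> lists S" "v \<in> lists S" for u v
    using that by (intro pairs.star_mult)
  then show ?thesis by auto
qed

lemma rational_transductionE:
  assumes "rational_transduction S T"
  obtains E :: "(nat \<times> ('a list \<times> 'a list) \<times> nat) set" and I F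
  where "finite E" "finite I" "finite F"
    "\<forall>(p, x, q) \<in> E. x \<in> insert ([], []) (letter_pairs S)"
    "T = {m. \<exists>p\<in>I. \<exists>q\<in>F. pairs.path E p m q}"
proof -
  have "pairs.accepted_by_automaton (letter_pairs S) T"
    using pairs.rational_accepted_by_automaton[OF pairs_generated] assms
    unfolding rational_transduction_def .
  then show ?thesis by (rule pairs.accepted_by_automatonE) (rule that)
qed

lemma letter_pairs_subset: "letter_pairs S \<subseteq> lists S \<times> lists S"
  by (auto simp: letter_pairs_def)

lemma rational_transduction_subset:
  "rational_transduction S T \<Longrightarrow> T \<subseteq> lists S \<times> lists S"
  unfolding rational_transduction_def by (rule pairs.rational_subset)

lemma rational_transduction_Un:
  "rational_transduction S T \<Longrightarrow> rational_transduction S T' \<Longrightarrow> rational_transduction S (T \<union> T')"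
  unfolding rational_transduction_def by (rule rs_union)

lemma rational_transduction_converse:
  assumes "rational_transduction S T"
  shows "rational_transduction S (T\<inverse>)"
proof -
  have "prod.swap ` T \<in> rational_subsets pair_append ([], []) (lists S \<times> lists S)"
    using assms unfolding rational_transduction_def by (rule rational_hom) auto
  moreover have "prod.swap ` T = T\<inverse>" by force
  ultimately show ?thesis by (simp add: rational_transduction_def)
qed

lemma regular_Domain:
  assumes "rational_transduction S T"
  shows "regular_lang S (Domain T)"
  using assms unfolding rational_transduction_def regular_lang_def Domain_fst
  by (rule rational_hom) auto

text \<open>Product construction: next to the transducer, a quotient of \<open>A\<close> follows the
  first tape and a quotient of \<open>B\<close> the second. Acceptance also requires both quotients
  to contain the empty word.\<close>

lemma rational_transduction_restrict:
  assumes "rational_transduction S T" "regular_lang S A" "regular_lang S B"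
  shows "rational_transduction S (T \<inter> A \<times> B)"
proof -
  obtain E :: "(nat \<times> ('a list \<times> 'a list) \<times> nat) set" and I F where
    E: "finite E" "finite I" "finite F"
    and labels_all: "\<forall>(p, x, q) \<in> E. x \<in> insert ([], []) (letter_pairs S)"
    and T: "T = {m. \<exists>p\<in>I. \<exists>q\<in>F. pairs.path E p m q}"
    using assms(1) by (rule rational_transductionE)
  have labels: "x = ([], []) \<or> x \<in> letter_pairs S" if "(p, x, q) \<in> E" for p x q
    using that labels_all by auto
  let ?A = "range (residual A)" and ?B = "range (residual B)"
  have fin: "finite ?A" "finite ?B" using assms by (auto intro: finite_residuals_regular)
  define D where "D = (\<lambda>((p, (x, y), q), K, K'). ((p, K, K'), (x, y), (q, residual K x, residual K' y)))
    ` (E \<times> ?A \<times> ?B)"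
  have closed: "residual K w \<in> ?A" if "K \<in> ?A" for K w
    using that by (auto simp flip: residual_append)
  have closed': "residual K w \<in> ?B" if "K \<in> ?B" for K w
    using that by (auto simp flip: residual_append)
  have forth: "pairs.path D (p, K, K') (x, y) (q, residual K x, residual K' y)"
    if "pairs.path E p m q" "m = (x, y)" "K \<in> ?A" "K' \<in> ?B" for p m q x y K K'
    using that
  proof (induction arbitrary: x y K K' rule: pairs.path.induct)
    case (path_refl p)
    then show ?case by (simp add: pairs.path_refl)
  next
    case (path_step p l r m q)
    obtain a b x' y' where lm: "l = (a, b)" "m = (x', y')" by fastforce
    have "((p, K, K'), (a, b), (r, residual K a, residual K' b)) \<in> D"
      using path_step.hyps path_step.prems unfolding D_def lm
      by (intro image_eqI[of _ _ "((p, (a, b), r), K, K')"]) auto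
    moreover have "pairs.path D (r, residual K a, residual K' b) (x', y')
      (q, residual (residual K a) x', residual (residual K' b) y')"
      using path_step.prems lm by (intro path_step.IH closed closed') auto
    ultimately show ?case using path_step.prems lm pairs.path_step
      by (fastforce simp: residual_append)
  qed
  \<comment> \<open>Conversely, the quotients at the end of a path of \<open>D\<close> are forced by
    those at its start and by its label.\<close>
  have "pairs.path E (fst s) m (fst t) \<and> fst (snd t) = residual (fst (snd s)) (fst m)
    \<and> snd (snd t) = residual (snd (snd s)) (snd m)" if "pairs.path D s m t" for s m t
    using that
  proof (induction rule: pairs.path.induct)
    case (path_refl p)
    then show ?case by (simp add: pairs.path_refl)
  next
    case (path_step s l r m t)
    then show ?case
      by (cases m) (auto simp: D_def residual_append intro: pairs.path_step[of _ "(_, _)" _ _ "(_, _)", simplified])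
  qed
  then have project: "pairs.path E p (x, y) q \<and> K1 = residual K x \<and> K1' = residual K' y"
    if "pairs.path D (p, K, K') (x, y) (q, K1, K1')" for p K K' x y q K1 K1'
    using that by fastforce
  have "T \<inter> A \<times> B = {m. \<exists>s\<in>I \<times> {A} \<times> {B}.
      \<exists>t\<in>F \<times> {K \<in> ?A. [] \<in> K} \<times> {K \<in> ?B. [] \<in> K}. pairs.path D s m t}"
    (is "_ = ?R")
  proof (intro subset_antisym subsetI)
    fix m assume "m \<in> T \<inter> A \<times> B"
    then obtain x y p q where *: "m = (x, y)" "x \<in> A" "y \<in> B" "p \<in> I" "q \<in> F" "pairs.path E p (x, y) q"
      unfolding T by auto
    have AB: "A \<in> ?A" "B \<in> ?B" by (auto intro: range_eqI[of _ _ "[]"])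
    have "pairs.path D (p, A, B) (x, y) (q, residual A x, residual B y)"
      using *(6) refl AB by (rule forth)
    then show "m \<in> ?R" using * by (auto intro!: bexI)
  next
    fix m assume "m \<in> ?R"
    then obtain x y p q K K' where "m = (x, y)" "p \<in> I" "q \<in> F" "[] \<in> K" "[] \<in> K'"
      "pairs.path D (p, A, B) (x, y) (q, K, K')"
      by (cases m) blast
    moreover from this(6) have "pairs.path E p (x, y) q" "K = residual A x" "K' = residual B y"
      using project by blast+
    ultimately show "m \<in> T \<inter> A \<times> B" unfolding T by auto
  qed
  also have "\<dots> \<in> rational_subsets pair_append ([], []) (lists S \<times> lists S)"
  proof (rule pairs.rational_accepted)
    show "finite D" unfolding D_def using E fin by blast
    fix s x t assume "(s, x, t) \<in> D"
    then obtain p q where "(p, x, q) \<in> E" by (auto simp: D_def)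
    then show "x \<in> lists S \<times> lists S" using labels letter_pairs_subset by blast
  qed (use E fin in auto)
  finally show ?thesis by (simp add: rational_transduction_def)
qed

text \<open>Both transducers run side by side and the middle tape is hidden: the first moves without
  writing (\<open>D1\<close>), the second moves without reading (\<open>D2\<close>), or a letter
  written by the first is at once read by the second (\<open>D3\<close>). One-letter labels make
  this synchronisation possible.\<close>

lemma rational_transduction_relcomp:
  assumes "rational_transduction S T" "rational_transduction S T'"
  shows "rational_transduction S (T O T')"
proof -
  obtain E :: "(nat \<times> ('a list \<times> 'a list) \<times> nat) set" and I F where
    E: "finite E" "finite I" "finite F"
    and labels_all: "\<forall>(p, x, q) \<in> E. x \<in> insert ([], []) (letter_pairs S)"
    and T: "T = {m. \<exists>p\<in>I. \<exists>q\<in>F. pairs.path E p m q}"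
    using assms(1) by (rule rational_transductionE)
  have labels: "x = ([], []) \<or> x \<in> letter_pairs S" if "(p, x, q) \<in> E" for p x q
    using that labels_all by auto
  obtain E' :: "(nat \<times> ('a list \<times> 'a list) \<times> nat) set" and I' F' where
    E': "finite E'" "finite I'" "finite F'"
    and labels'_all: "\<forall>(p, x, q) \<in> E'. x \<in> insert ([], []) (letter_pairs S)"
    and T': "T' = {m. \<exists>p\<in>I'. \<exists>q\<in>F'. pairs.path E' p m q}"
    using assms(2) by (rule rational_transductionE)
  have labels': "x = ([], []) \<or> x \<in> letter_pairs S" if "(p, x, q) \<in> E'" for p x q
    using that labels'_all by auto
  \<comment> \<open>The component that rests during a move ranges over initial states and targets of
    edges only; this keeps \<open>D\<close> finite.\<close>
  define Q where "Q = I \<union> (snd \<circ> snd) ` E"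
  define Q' where "Q' = I' \<union> (snd \<circ> snd) ` E'"
  define D1 :: "((nat \<times> nat) \<times> ('a list \<times> 'a list) \<times> (nat \<times> nat)) set" where "D1 = {((p, q), (x, []), (p', q)) | p x p' q. (p, (x, []), p') \<in> E \<and> q \<in> Q'}"
  define D2 :: "((nat \<times> nat) \<times> ('a list \<times> 'a list) \<times> (nat \<times> nat)) set" where "D2 = {((p, q), ([], y), (p, q')) | p q y q'. (q, ([], y), q') \<in> E' \<and> p \<in> Q}"
  define D3 :: "((nat \<times> nat) \<times> ('a list \<times> 'a list) \<times> (nat \<times> nat)) set" where "D3 = {((p, q), ([], []), (p', q')) | p q p' q'.
    \<exists>a. (p, ([], [a]), p') \<in> E \<and> (q, ([a], []), q') \<in> E'}"
  define D where "D = D1 \<union> D2 \<union> D3"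
  have Q: "r \<in> Q" if "(p, x, r) \<in> E" for p x r using that by (force simp: Q_def)
  have Q': "r \<in> Q'" if "(p, x, r) \<in> E'" for p x r using that by (force simp: Q'_def)
  have finQ: "finite Q" "finite Q'" using E E' by (auto simp: Q_def Q'_def)
  have "finite D1"
    by (rule finite_subset[of _ "(\<lambda>((p, l, p'), q). ((p, q), l, (p', q))) ` (E \<times> Q')"])
      (use E finQ in \<open>auto simp: D1_def intro: rev_image_eqI\<close>)
  moreover have "finite D2"
    by (rule finite_subset[of _ "(\<lambda>((q, l, q'), p). ((p, q), l, (p, q'))) ` (E' \<times> Q)"])
      (use E' finQ in \<open>auto simp: D2_def intro: rev_image_eqI\<close>)
  moreover have "finite D3"
    by (rule finite_subset[of _ "(\<lambda>((p, l, p'), (q, l', q')). ((p, q), ([], []), (p', q'))) ` (E \<times> E')"])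
      (use E E' in \<open>auto simp: D3_def intro: rev_image_eqI\<close>)
  ultimately have "finite D" by (simp add: D_def)
  have D_labels: "x \<in> lists S \<times> lists S" if "(s, x, t) \<in> D" for s x t
  proof -
    have "x = ([], []) \<or> x \<in> letter_pairs S"
      using that labels labels' by (fastforce simp: D_def D1_def D2_def D3_def)
    then show ?thesis using letter_pairs_subset by blast
  qed
  have split: "\<exists>y. pairs.path E (fst s) (fst m, y) (fst t) \<and> pairs.path E' (snd s) (y, snd m) (snd t)"
    if "pairs.path D s m t" for s m t
    using that
  proof (induction rule: pairs.path.induct)
    case (path_refl s)
    then show ?case using pairs.path_refl by fastforce
  next
    case (path_step s l r m t)
    then obtain y where y: "pairs.path E (fst r) (fst m, y) (fst t)"
      "pairs.path E' (snd r) (y, snd m) (snd t)" by blast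
    from path_step.hyps(1) consider "(s, l, r) \<in> D1" | "(s, l, r) \<in> D2" | "(s, l, r) \<in> D3"
      by (auto simp: D_def)
    then show ?case
    proof cases
      case 1
      then obtain x where "l = (x, [])" "(fst s, (x, []), fst r) \<in> E" "snd r = snd s"
        by (auto simp: D1_def)
      then show ?thesis using pairs.path_step[OF _ y(1)] y(2) by (cases m) fastforce
    next
      case 2
      then obtain z where "l = ([], z)" "(snd s, ([], z), snd r) \<in> E'" "fst r = fst s"
        by (auto simp: D2_def)
      then show ?thesis using pairs.path_step[OF _ y(2)] y(1) by (cases m) fastforce
    next
      case 3
      then obtain a where "l = ([], [])" "(fst s, ([], [a]), fst r) \<in> E" "(snd s, ([a], []), snd r) \<in> E'"
        by (auto simp: D3_def)
      then show ?thesis using pairs.path_step[OF _ y(1)] pairs.path_step[OF _ y(2)]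
        by (cases m) fastforce
    qed
  qed
  have right: "pairs.path D (p, q) ([], z) (p, q')"
    if "pairs.path E' q n q'" "n = ([], z)" "p \<in> Q" for p q n q' z
    using that
  proof (induction arbitrary: z rule: pairs.path.induct)
    case (path_refl q)
    then show ?case by (simp add: pairs.path_refl)
  next
    case (path_step q l r n q')
    then obtain z1 z2 where z: "l = ([], z1)" "n = ([], z2)" "z = z1 @ z2"
      by (cases l; cases n) auto
    have "((p, q), ([], z1), (p, r)) \<in> D" using path_step z by (auto simp: D_def D2_def)
    from pairs.path_step[OF this path_step.IH[OF z(2) path_step.prems(2)]]
    show ?case by (simp add: z)
  qed
  \<comment> \<open>Cuts the second run at the edge that consumes the first letter \<open>a\<close>.
    All edges before it read nothing and can be simulated by \<open>D2\<close> alone.\<close>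
  have first_input: "\<exists>q1 q2 z1 z2. pairs.path E' q ([], z1) q1 \<and> (q1, ([a], []), q2) \<in> E'
      \<and> pairs.path E' q2 (y, z2) q' \<and> z = z1 @ z2"
    if "pairs.path E' q n q'" "n = (a # y, z)" for q n q' a y z
    using that
  proof (induction arbitrary: z rule: pairs.path.induct)
    case (path_step q l r n q')
    obtain z1 z2 where lz: "snd l = z1" "snd n = z2" "z = z1 @ z2"
      using path_step.prems by (cases l; cases n) auto
    show ?case
    proof (cases "fst l = []")
      case True
      then have "n = (a # y, z2)" "l = ([], z1)" using path_step.prems lz by (cases l; cases n; auto)+
      from path_step.IH[OF this(1)] obtain q1 q2 u1 u2 where *:
        "pairs.path E' r ([], u1) q1" "(q1, ([a], []), q2) \<in> E'" "pairs.path E' q2 (y, u2) q'"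
        "z2 = u1 @ u2" by blast
      have "pairs.path E' q ([], z1 @ u1) q1"
        using pairs.path_step[OF path_step.hyps(1) *(1)] \<open>l = _\<close> by simp
      then show ?thesis using * lz by (metis append.assoc)
    next
      case False
      then have "l = ([a], [])" "n = (y, z)"
        using labels'[OF path_step.hyps(1)] path_step.prems
        by (cases n; auto simp: letter_pairs_def)+
      then show ?thesis using path_step.hyps pairs.path_refl by (metis append_Nil)
    qed
  qed simp
  \<comment> \<open>Induction on the first run. Each letter it writes calls up the next portion of
    the second run through \<open>first_input\<close>; what is left of that run at the end reads
    nothing and is handled by \<open>right\<close>.\<close>
  have join: "pairs.path D (p, q) (x, z) (p', q')"
    if "pairs.path E p m p'" "m = (x, y)" "pairs.path E' q (y, z) q'" "p \<in> Q" "q \<in> Q'"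
    for p m p' x y z q q'
    using that
  proof (induction arbitrary: x y z q rule: pairs.path.induct)
    case (path_refl p)
    then show ?case using right by auto
  next
    case (path_step p l r m p')
    obtain l1 l2 x' y' where lm: "l = (l1, l2)" "m = (x', y')" by fastforce
    have xy: "x = l1 @ x'" "y = l2 @ y'" using path_step.prems lm by auto
    have r: "r \<in> Q" using path_step.hyps(1) by (rule Q)
    show ?case
    proof (cases l2)
      case Nil
      have "((p, q), (l1, []), (r, q)) \<in> D"
        using path_step.hyps path_step.prems lm Nil by (auto simp: D_def D1_def)
      moreover have "pairs.path D (r, q) (x', z) (p', q')"
        using path_step.prems xy Nil r by (intro path_step.IH[OF lm(2)]) auto
      ultimately show ?thesis using pairs.path_step xy by fastforce
    next
      case (Cons a l2')
      then have l: "l1 = []" "l2 = [a]"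
        using labels[OF path_step.hyps(1)] lm by (auto simp: letter_pairs_def)
      with xy path_step.prems(2) obtain q1 q2 z1 z2 where *:
        "pairs.path E' q ([], z1) q1" "(q1, ([a], []), q2) \<in> E'" "pairs.path E' q2 (y', z2) q'"
        "z = z1 @ z2" using first_input[OF path_step.prems(2)] by fastforce
      have "pairs.path D (p, q) ([], z1) (p, q1)"
        using *(1) refl path_step.prems(3) by (rule right)
      moreover have "((p, q1), ([], []), (r, q2)) \<in> D"
        using *(2) path_step.hyps(1) lm l by (auto simp: D_def D3_def)
      moreover have "pairs.path D (r, q2) (x', z2) (p', q')"
        using *(2,3) r Q' by (intro path_step.IH[OF lm(2)])
      ultimately have "pairs.path D (p, q) (pair_append ([], z1) (pair_append ([], []) (x', z2))) (p', q')"
        by (intro pairs.path_trans[of _ _ _ "(p, q1)"] pairs.path_step)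
      then show ?thesis using * xy l by simp
    qed
  qed
  have "T O T' = {m. \<exists>s\<in>I \<times> I'. \<exists>t\<in>F \<times> F'. pairs.path D s m t}" (is "_ = ?R")
  proof (intro subset_antisym subsetI)
    fix m assume "m \<in> T O T'"
    then obtain x y z p q p' q' where "m = (x, z)" "p \<in> I" "q \<in> I'" "p' \<in> F" "q' \<in> F'"
      "pairs.path E p (x, y) p'" "pairs.path E' q (y, z) q'"
      unfolding T T' by blast
    moreover from this have "pairs.path D (p, q) (x, z) (p', q')"
      by (intro join[OF _ refl]) (auto simp: Q_def Q'_def)
    ultimately show "m \<in> ?R" by blast
  next
    fix m assume "m \<in> ?R"
    then obtain p q p' q' where "p \<in> I" "q \<in> I'" "p' \<in> F" "q' \<in> F'"
      "pairs.path D (p, q) m (p', q')" by blast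
    moreover from split[OF this(5)] obtain y where
      "pairs.path E p (fst m, y) p'" "pairs.path E' q (y, snd m) q'" by auto
    ultimately have "(fst m, y) \<in> T" "(y, snd m) \<in> T'" unfolding T T' by blast+
    then show "m \<in> T O T'" by (metis relcomp.relcompI surjective_pairing)
  qed
  also have "\<dots> \<in> rational_subsets pair_append ([], []) (lists S \<times> lists S)"
    by (rule pairs.rational_accepted) (use \<open>finite D\<close> D_labels E E' in auto)
  finally show ?thesis by (simp add: rational_transduction_def)
qed

section \<open>Context-free grammars\<close>

lemma cfg_gen_append:
  "cfg_gen P s u \<Longrightarrow> cfg_gen P t v \<Longrightarrow> cfg_gen P (s @ t) (u @ v)"
  by (induction rule: cfg_gen.induct) (auto intro: cfg_gen.intros)

lemma cfg_gen_production: "(A, rhs) \<in> P \<Longrightarrow> cfg_gen P rhs u \<Longrightarrow> cfg_gen P [Inr A] u"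
  using cg_nonterm[OF _ _ cg_nil] by fastforce

lemma cfg_gen_nonterminalE:
  assumes "cfg_gen P [Inr A] u"
  obtains rhs where "(A, rhs) \<in> P" "cfg_gen P rhs u"
  using assms by (auto elim!: cfg_gen.cases[of P "[Inr A]"] elim: cfg_gen.cases[of P "[]"])

lemma cfg_gen_terminals: "cfg_gen P (map Inl w) w"
  by (induction w) (auto intro: cfg_gen.intros)

section \<open>Linear grammars from transducers\<close>

fun sentential_lang :: "(nat \<Rightarrow> 'a list set) \<Rightarrow> ('a + nat) list \<Rightarrow> 'a list set" where
  "sentential_lang X [] = {[]}"
| "sentential_lang X (Inl a # s) = (#) a ` sentential_lang X s"
| "sentential_lang X (Inr A # s) = set_mult (@) (X A) (sentential_lang X s)"

text \<open>The derivable words form the least solution of the inclusions given by the productions,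
  so any assignment \<open>X\<close> closed under the productions bounds them from above.\<close>

lemma cfg_gen_subset_solution:
  assumes "\<And>A rhs. (A, rhs) \<in> P \<Longrightarrow> sentential_lang X rhs \<subseteq> X A" "cfg_gen P s w"
  shows "w \<in> sentential_lang X s"
  using assms(2)
proof (induction rule: cfg_gen.induct)
  case (cg_nonterm A rhs u rest v)
  then have "u \<in> X A" using assms(1) by blast
  then show ?case using cg_nonterm.IH(2) by auto
qed auto

lemma sentential_lang_terminals:
  "sentential_lang X (map Inl w @ s) = (@) w ` sentential_lang X s"
  by (induction w) (auto simp: image_image)

text \<open>State \<open>p\<close> becomes nonterminal \<open>Suc p\<close>, and 0 is the start
  symbol. An edge from \<open>p\<close> to \<open>q\<close> yields a production that writes its
  first label to the left of \<open>Suc q\<close> and the inverse of its second label to the right.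
  Words grow from the outside inwards, so the second tape comes out reversed, as formal inversion
  demands.\<close>

lemma context_free_transduction:
  assumes "rational_transduction S T" "\<And>a. a \<in> S \<Longrightarrow> iv a \<in> S"
  shows "context_free (insert h S) {u @ [h] @ word_inv iv v | u v. (u, v) \<in> T}"
proof -
  obtain E :: "(nat \<times> ('a list \<times> 'a list) \<times> nat) set" and I F where
    E: "finite E" "finite I" "finite F"
    and labels: "\<forall>(p, x, q) \<in> E. x \<in> insert ([], []) (letter_pairs S)"
    and T: "T = {m. \<exists>p\<in>I. \<exists>q\<in>F. pairs.path E p m q}"
    using assms(1) by (rule rational_transductionE)
  let ?L = "{u @ [h] @ word_inv iv v | u v. (u, v) \<in> T}"
  let ?inv = "word_inv iv"
  define rule where "rule = (\<lambda>(p :: nat, (x, y), q).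
    (Suc p, map Inl x @ Inr (Suc q) # map Inl (?inv y) :: ('a + nat) list))"
  define P where "P = rule ` E \<union> (\<lambda>q. (Suc q, [Inl h])) ` F \<union> (\<lambda>p. (0, [Inr (Suc p)])) ` I"
  have rule: "rule (p, (x, y), q) = (Suc p, map Inl x @ Inr (Suc q) # map Inl (?inv y))" for p x y q
    by (simp add: rule_def)
  have letters: "x \<in> lists S" "y \<in> lists S" if "(p, (x, y), q) \<in> E" for p x y q
    using that labels letter_pairs_subset by fastforce+
  have inv_lists: "?inv y \<in> lists S" if "y \<in> lists S" for y
    using that assms(2) by (auto simp: word_inv_def)
  \<comment> \<open>The assignment for \<open>cfg_gen_subset_solution\<close>: \<open>Suc p\<close>
    stands for the words spelled by runs from \<open>p\<close> to a final state.\<close>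
  define X where "X n = (case n of 0 \<Rightarrow> ?L
    | Suc p \<Rightarrow> {u @ h # ?inv v | u v. \<exists>q\<in>F. pairs.path E p (u, v) q})" for n
  have X_Suc: "u @ h # ?inv v \<in> X (Suc p)" if "q \<in> F" "pairs.path E p (u, v) q" for p u v q
    using that by (auto simp: X_def)
  have "w \<in> X 0" if "cfg_gen P [Inr 0] w" for w
  proof -
    have "sentential_lang X rhs \<subseteq> X A" if "(A, rhs) \<in> P" for A rhs
    proof -
      from that consider p x y q where "(p, (x, y), q) \<in> E" "A = Suc p"
          "rhs = map Inl x @ Inr (Suc q) # map Inl (?inv y)"
        | q where "q \<in> F" "A = Suc q" "rhs = [Inl h]"
        | p where "p \<in> I" "A = 0" "rhs = [Inr (Suc p)]"
        by (auto simp: P_def rule_def)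
      then show ?thesis
      proof cases
        case 1
        have "x @ (u @ h # ?inv v) @ ?inv y \<in> X A"
          if "q' \<in> F" "pairs.path E q (u, v) q'" for u v q'
        proof -
          have "pairs.path E p (x @ u, y @ v) q'"
            using pairs.path_step[OF 1(1) that(2)] by simp
          with that(1) have "(x @ u) @ h # ?inv (y @ v) \<in> X (Suc p)" by (rule X_Suc)
          moreover have "x @ (u @ h # ?inv v) @ ?inv y = (x @ u) @ h # ?inv (y @ v)"
            by (simp add: word_inv_append)
          ultimately show ?thesis by (simp only: 1(2))
        qed
        then show ?thesis using sentential_lang_terminals[of X "?inv y" "[]"] 1
          by (auto simp: sentential_lang_terminals X_def)
      next
        case 2
        have "[] @ h # ?inv [] \<in> X (Suc q)" using 2(1) pairs.path_refl by (rule X_Suc)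
        then show ?thesis using 2 by simp
      next
        case 3
        then show ?thesis by (auto simp: X_def T)
      qed
    qed
    from cfg_gen_subset_solution[OF this that] show ?thesis by simp
  qed
  moreover have "cfg_gen P [Inr 0] w" if "w \<in> ?L" for w
  proof -
    have "cfg_gen P [Inr (Suc p)] (u @ h # ?inv v)"
      if "pairs.path E p m q" "q \<in> F" "m = (u, v)" for p m q u v
      using that
    proof (induction arbitrary: u v rule: pairs.path.induct)
      case (path_refl p)
      then have "(Suc p, [Inl h]) \<in> P" by (simp add: P_def)
      moreover have "cfg_gen P [Inl h] [h]" by (intro cfg_gen.intros)
      ultimately show ?case using path_refl cfg_gen_production by fastforce
    next
      case (path_step p l r m q)
      obtain x y u' v' where l: "l = (x, y)" "m = (u', v')" by fastforce
      have "rule (p, (x, y), r) \<in> P"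
        unfolding P_def using path_step.hyps(1) l by blast
      moreover have "cfg_gen P (map Inl x @ [Inr (Suc r)] @ map Inl (?inv y))
        (x @ (u' @ h # ?inv v') @ ?inv y)"
        using path_step.prems l by (intro cfg_gen_append cfg_gen_terminals path_step.IH)
      ultimately show ?case unfolding rule
        using cfg_gen_production path_step.prems l by (fastforce simp: word_inv_append)
    qed
    moreover from that obtain u v p q where
      "w = u @ h # ?inv v" "p \<in> I" "q \<in> F" "pairs.path E p (u, v) q" by (auto simp: T)
    moreover have "(0, [Inr (Suc p)]) \<in> P" using \<open>p \<in> I\<close> by (simp add: P_def)
    ultimately show ?thesis using cfg_gen_production by blast
  qed
  ultimately have "cfg_lang P 0 = ?L" by (auto simp: cfg_lang_def X_def)
  moreover have "finite P" using E by (simp add: P_def)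
  moreover have letter: "c \<in> insert h S" if "(A, rhs) \<in> P" "Inl c \<in> set rhs" for A rhs c
  proof -
    from that(1) consider p x y q where "(p, (x, y), q) \<in> E" "A = Suc p"
        "rhs = map Inl x @ Inr (Suc q) # map Inl (?inv y)"
      | "rhs = [Inl h]" | p where "rhs = [Inr (Suc p)]"
      by (auto simp: P_def rule_def)
    then show ?thesis
    proof cases
      case 1
      then have "set x \<subseteq> S" "set (?inv y) \<subseteq> S"
        using letters[OF 1(1)] inv_lists[of y] by (simp_all add: subset_iff in_lists_conv_set)
      then show ?thesis using that(2) 1(3) by auto
    qed (use that(2) in auto)
  qed
  moreover have "?L \<subseteq> lists (insert h S)"
  proof
    fix w assume "w \<in> ?L"
    then obtain u v where "w = u @ [h] @ ?inv v" "u \<in> lists S" "v \<in> lists S"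
      using rational_transduction_subset[OF assms(1)] by blast
    then show "w \<in> lists (insert h S)" using inv_lists[of v] by auto
  qed
  ultimately show ?thesis unfolding context_free_def
    by (intro conjI exI[of _ P] exI[of _ 0]) (auto split: sum.split dest!: letter)
qed

text \<open>If every symbol of \<open>s\<close> contributed at most \<open>N\<close> letters, the
  word would be too short, so some nonterminal derives more than \<open>N\<close> letters. If it
  derives more than \<open>m * N\<close>, its right-hand side satisfies the same hypothesis and the
  search descends; otherwise the factor is found.\<close>

lemma cfg_gen_moderate_factor:
  assumes "cfg_gen P s w" "1 \<le> N" "\<And>A rhs. (A, rhs) \<in> P \<Longrightarrow> length rhs \<le> m"
    "length s * N < length w"
  shows "\<exists>p b q A. w = p @ b @ q \<and> N < length b \<and> length b \<le> m * N \<and> cfg_gen P [Inr A] b \<and>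
    (\<forall>z. cfg_gen P [Inr A] z \<longrightarrow> cfg_gen P s (p @ z @ q))"
  using assms(1,4)
proof (induction rule: cfg_gen.induct)
  case cg_nil
  then show ?case by simp
next
  case (cg_term rest v a)
  \<comment> \<open>Here \<open>1 \<le> N\<close> enters: the one letter of a terminal counts for at
    most \<open>N\<close>.\<close>
  then have "length rest * N < length v" using assms(2) by simp
  from cg_term.IH[OF this] obtain p b q A where *: "v = p @ b @ q" "N < length b"
    "length b \<le> m * N" "cfg_gen P [Inr A] b"
    "\<forall>z. cfg_gen P [Inr A] z \<longrightarrow> cfg_gen P rest (p @ z @ q)" by blast
  moreover from *(5) have "\<forall>z. cfg_gen P [Inr A] z \<longrightarrow> cfg_gen P (Inl a # rest) ((a # p) @ z @ q)"
    by (auto intro: cfg_gen.cg_term)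
  moreover have "a # v = (a # p) @ b @ q" using * by simp
  ultimately show ?case by blast
next
  case (cg_nonterm A rhs u rest v)
  consider "length rest * N < length v" | "N < length u" "length u \<le> m * N" | "m * N < length u"
    using cg_nonterm.prems by fastforce
  then show ?case
  proof cases
    case 1
    from cg_nonterm.IH(2)[OF 1] obtain p b q B where *: "v = p @ b @ q" "N < length b"
      "length b \<le> m * N" "cfg_gen P [Inr B] b"
      "\<forall>z. cfg_gen P [Inr B] z \<longrightarrow> cfg_gen P rest (p @ z @ q)" by blast
    moreover from *(5) have
      "\<forall>z. cfg_gen P [Inr B] z \<longrightarrow> cfg_gen P (Inr A # rest) ((u @ p) @ z @ q)"
      using cfg_gen.cg_nonterm[OF cg_nonterm.hyps(1,2)] by auto
    moreover have "u @ v = (u @ p) @ b @ q" using * by simp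
    ultimately show ?thesis by blast
  next
    case 2
    moreover have "cfg_gen P [Inr A] u" using cg_nonterm.hyps(1,2) by (rule cfg_gen_production)
    moreover have "\<forall>z. cfg_gen P [Inr A] z \<longrightarrow> cfg_gen P (Inr A # rest) ([] @ z @ v)"
      using cfg_gen_append[OF _ cg_nonterm.hyps(3), of "[Inr A]"] by simp
    moreover have "u @ v = [] @ u @ v" by simp
    ultimately show ?thesis by blast
  next
    case 3
    have "length rhs * N \<le> m * N" using assms(3)[OF cg_nonterm.hyps(1)] by simp
    then have "length rhs * N < length u" using 3 by (rule le_less_trans)
    from cg_nonterm.IH(1)[OF this] obtain p b q B where *: "u = p @ b @ q" "N < length b"
      "length b \<le> m * N" "cfg_gen P [Inr B] b"
      "\<forall>z. cfg_gen P [Inr B] z \<longrightarrow> cfg_gen P rhs (p @ z @ q)" by blast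
    moreover from *(5) have
      "\<forall>z. cfg_gen P [Inr B] z \<longrightarrow> cfg_gen P (Inr A # rest) (p @ z @ q @ v)"
      using cfg_gen.cg_nonterm[OF cg_nonterm.hyps(1) _ cg_nonterm.hyps(3)] by fastforce
    moreover have "u @ v = p @ b @ q @ v" using * by simp
    ultimately show ?thesis by blast
  qed
qed

text \<open>Only finitely many pairs of a nonterminal and a class occur. One word is fixed for each
  pair, and \<open>N\<close> bounds the lengths of these words, so a factor longer than
  \<open>N\<close> derived from a nonterminal can be exchanged for the fixed word of its pair.
  \<alpha> and \<beta> express that \<open>s\<close> is a segment of a right-hand side, which bounds
  its length.\<close>

lemma cfg_gen_shorten:
  fixes cls :: "'a list \<Rightarrow> 'c"
  assumes "finite P" "finite (range cls)"
  shows "\<exists>K. \<forall>A \<alpha> s \<beta> w. (A, \<alpha> @ s @ \<beta>) \<in> P \<and> cfg_gen P s w \<and> K < length w \<longrightarrow>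
    (\<exists>p b q z. w = p @ b @ q \<and> length z < length b \<and> length b \<le> K \<and> cls z = cls b \<and>
      cfg_gen P s (p @ z @ q))"
proof -
  let ?I = "{(A, cls b) | A b. cfg_gen P [Inr A] b}"
  have "?I \<subseteq> fst ` P \<times> range cls"
    by (force elim: cfg_gen_nonterminalE)
  then have "finite ?I" using assms by (auto elim: finite_subset)
  define f where "f = (\<lambda>(A, c). SOME b. cfg_gen P [Inr A] b \<and> cls b = c)"
  have f: "cfg_gen P [Inr A] (f (A, cls b)) \<and> cls (f (A, cls b)) = cls b"
    if "cfg_gen P [Inr A] b" for A b
    unfolding f_def using someI[of "\<lambda>b'. cfg_gen P [Inr A] b' \<and> cls b' = cls b"] that by simp
  define N where "N = Suc (\<Sum>i\<in>?I. length (f i))"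
  have N: "length (f (A, cls b)) \<le> N" if "cfg_gen P [Inr A] b" for A b
  proof -
    have "length (f (A, cls b)) \<le> (\<Sum>i\<in>?I. length (f i))"
      by (rule member_le_sum) (use that \<open>finite ?I\<close> in auto)
    then show ?thesis by (simp add: N_def)
  qed
  define m where "m = (\<Sum>d\<in>P. length (snd d))"
  have m: "length rhs \<le> m" if "(A, rhs) \<in> P" for A rhs
    unfolding m_def using member_le_sum[of "(A, rhs)" P "\<lambda>d. length (snd d)"] that assms(1) by simp
  show ?thesis
  proof (intro exI[of _ "m * N"] allI impI, elim conjE)
    fix A \<alpha> s \<beta> w assume *: "(A, \<alpha> @ s @ \<beta>) \<in> P" "cfg_gen P s w" "m * N < length w"
    have "length s * N \<le> m * N" using m[OF *(1)] by simp
    then have "length s * N < length w" using *(3) by (rule le_less_trans)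
    moreover have "1 \<le> N" by (simp add: N_def)
    ultimately have "\<exists>p b q B. w = p @ b @ q \<and> N < length b \<and> length b \<le> m * N \<and>
        cfg_gen P [Inr B] b \<and> (\<forall>z. cfg_gen P [Inr B] z \<longrightarrow> cfg_gen P s (p @ z @ q))"
      using *(2) m by (intro cfg_gen_moderate_factor)
    then obtain p b q B where pbq: "w = p @ b @ q" "N < length b" "length b \<le> m * N"
      and b: "cfg_gen P [Inr B] b" and repl: "\<forall>z. cfg_gen P [Inr B] z \<longrightarrow> cfg_gen P s (p @ z @ q)"
      by blast
    have "length (f (B, cls b)) < length b" using N[OF b] pbq(2) by simp
    then show "\<exists>p b q z. w = p @ b @ q \<and> length z < length b \<and> length b \<le> m * N \<and>
        cls z = cls b \<and> cfg_gen P s (p @ z @ q)"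
      using pbq f[OF b] repl by blast
  qed
qed

text \<open>The branch of a derivation tree that leads to a given occurrence of the letter \<open>h\<close>:
  every production on it contributes one piece on the left and one on the right of \<open>h\<close>.\<close>

inductive spine :: "(nat \<times> ('a + nat) list) set \<Rightarrow> 'a \<Rightarrow> ('a list \<Rightarrow> bool) \<Rightarrow>
    nat \<Rightarrow> 'a list \<Rightarrow> 'a list \<Rightarrow> bool" for P h ok where
  spine_base: "(A, \<alpha> @ Inl h # \<beta>) \<in> P \<Longrightarrow> cfg_gen P \<alpha> u \<Longrightarrow> cfg_gen P \<beta> w \<Longrightarrow> ok u \<Longrightarrow> ok w \<Longrightarrow>
     spine P h ok A u w"
| spine_step: "(A, \<alpha> @ Inr B # \<beta>) \<in> P \<Longrightarrow> cfg_gen P \<alpha> u \<Longrightarrow> cfg_gen P \<beta> w \<Longrightarrow> ok u \<Longrightarrow> ok w \<Longrightarrow>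
     spine P h ok B u' w' \<Longrightarrow> spine P h ok A (u @ u') (w' @ w)"

lemma spine_cfg_gen: "spine P h ok A u w \<Longrightarrow> cfg_gen P [Inr A] (u @ h # w)"
proof (induction rule: spine.induct)
  case (spine_base A \<alpha> \<beta> u w)
  then have "cfg_gen P (\<alpha> @ [Inl h] @ \<beta>) (u @ [h] @ w)"
    by (intro cfg_gen_append cfg_gen.intros)
  then show ?case using cfg_gen_production[OF spine_base.hyps(1)] by simp
next
  case (spine_step A \<alpha> B \<beta> u w u' w')
  then have "cfg_gen P (\<alpha> @ [Inr B] @ \<beta>) (u @ (u' @ h # w') @ w)"
    by (intro cfg_gen_append)
  then show ?case using cfg_gen_production[OF spine_step.hyps(1)] by simp
qed

text \<open>One symbol of \<open>s\<close> covers the marked occurrence of \<open>h\<close>: the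
  terminal \<open>h\<close> itself or a nonterminal. For a nonterminal, the induction hypothesis on
  its right-hand side supplies the spine.\<close>

lemma cfg_gen_split_spine:
  assumes "cfg_gen P s v" "v = u @ h # w"
  shows "\<exists>\<alpha> \<beta> u1 w1. cfg_gen P \<alpha> u1 \<and> cfg_gen P \<beta> w1 \<and>
    (s = \<alpha> @ Inl h # \<beta> \<and> u = u1 \<and> w = w1 \<or>
     (\<exists>B u2 w2. s = \<alpha> @ Inr B # \<beta> \<and> u = u1 @ u2 \<and> w = w2 @ w1 \<and> spine P h (\<lambda>_. True) B u2 w2))"
  using assms
proof (induction arbitrary: u w rule: cfg_gen.induct)
  case cg_nil
  then show ?case by simp
next
  case (cg_term rest v a)
  show ?case
  proof (cases u)
    case Nil
    then have "Inl a # rest = [] @ Inl h # rest" "w = v" using cg_term.prems by auto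
    then show ?thesis using Nil cg_term.hyps cfg_gen.cg_nil by blast
  next
    case (Cons a' u')
    then have "v = u' @ h # w" "a' = a" using cg_term.prems by auto
    from cg_term.IH[OF this(1)] obtain \<alpha> \<beta> u1 w1 where
      *: "cfg_gen P \<alpha> u1" "cfg_gen P \<beta> w1"
      "rest = \<alpha> @ Inl h # \<beta> \<and> u' = u1 \<and> w = w1 \<or> (\<exists>B u2 w2. rest = \<alpha> @ Inr B # \<beta> \<and>
        u' = u1 @ u2 \<and> w = w2 @ w1 \<and> spine P h (\<lambda>_. True) B u2 w2)" by blast
    have "cfg_gen P (Inl a # \<alpha>) (a # u1)" using *(1) by (rule cfg_gen.cg_term)
    then show ?thesis using * Cons \<open>a' = a\<close>
      by (intro exI[of _ "Inl a # \<alpha>"] exI[of _ \<beta>] exI[of _ "a # u1"] exI[of _ w1]) auto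
  qed
next
  case (cg_nonterm A rhs x rest v)
  from cg_nonterm.prems obtain us where
    "x = u @ us \<and> us @ v = h # w \<or> x @ us = u \<and> v = us @ h # w"
    unfolding append_eq_append_conv2 by blast
  then consider w' where "x = u @ h # w'" "w = w' @ v" | u' where "u = x @ u'" "v = u' @ h # w"
    by (cases us) auto
  then show ?case
  proof cases
    case 1
    from cg_nonterm.IH(1)[OF 1(1)] have "spine P h (\<lambda>_. True) A u w'"
      using cg_nonterm.hyps(1) by (auto intro: spine.intros)
    then show ?thesis using 1 cg_nonterm.hyps(3) cfg_gen.cg_nil
      by (intro exI[of _ "[]"] exI[of _ rest] exI[of _ "[]"] exI[of _ v]) auto
  next
    case 2
    from cg_nonterm.IH(2)[OF 2(2)] obtain \<alpha> \<beta> u1 w1 where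
      *: "cfg_gen P \<alpha> u1" "cfg_gen P \<beta> w1"
      "rest = \<alpha> @ Inl h # \<beta> \<and> u' = u1 \<and> w = w1 \<or> (\<exists>B u2 w2. rest = \<alpha> @ Inr B # \<beta> \<and>
        u' = u1 @ u2 \<and> w = w2 @ w1 \<and> spine P h (\<lambda>_. True) B u2 w2)" by blast
    have "cfg_gen P (Inr A # \<alpha>) (x @ u1)" using cg_nonterm.hyps(1,2) *(1) by (rule cfg_gen.cg_nonterm)
    then show ?thesis using * 2
      by (intro exI[of _ "Inr A # \<alpha>"] exI[of _ \<beta>] exI[of _ "x @ u1"] exI[of _ w1]) auto
  qed
qed

lemma cfg_gen_spine:
  assumes "cfg_gen P [Inr A] (u @ h # w)"
  shows "spine P h (\<lambda>_. True) A u w"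
proof -
  obtain rhs where rhs: "(A, rhs) \<in> P" "cfg_gen P rhs (u @ h # w)"
    using assms by (rule cfg_gen_nonterminalE)
  from cfg_gen_split_spine[OF rhs(2) refl] show ?thesis
    using rhs(1) by (auto intro: spine.intros)
qed

text \<open>\<open>L u w\<close> stands for membership of the separated word, and the exchange may
  happen on either side. The function \<open>cls\<close> is constant in the first application and
  gives contexts in a regular language in the second. The bound \<open>K\<close> leaves finitely
  many \<open>b\<close> over a finite alphabet.\<close>

definition shortenable :: "('a list \<Rightarrow> 'c) \<Rightarrow> nat \<Rightarrow> ('a list \<Rightarrow> 'a list \<Rightarrow> bool) \<Rightarrow>
    'a list \<Rightarrow> 'a list \<Rightarrow> bool" where
  "shortenable cls K L u w \<longleftrightarrow> (\<exists>p b q z. length z < length b \<and> length b \<le> K \<and> cls z = cls b \<and>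
     (u = p @ b @ q \<and> L (p @ z @ q) w \<or> w = p @ b @ q \<and> L u (p @ z @ q)))"

lemma shortenable_mono:
  "shortenable cls K L u w \<Longrightarrow> (\<And>u w. L u w \<Longrightarrow> L' u w) \<Longrightarrow> shortenable cls K L' u w"
  unfolding shortenable_def by (elim ex_forward conj_forward disj_forward) auto

text \<open>Each piece off the branch is derived from a segment of a right-hand side, so
  \<open>cfg_gen_shorten\<close> applies to any piece longer than \<open>K\<close>. If there is
  none, the condition on the pieces of the spine can be strengthened from \<open>True\<close> to the
  bound.\<close>

lemma spine_bounded_or_shortenable:
  fixes cls :: "'a list \<Rightarrow> 'c"
  assumes "finite P" "finite (range cls)"
  shows "\<exists>K. \<forall>A u w. cfg_gen P [Inr A] (u @ h # w) \<and> u \<in> lists S \<and> w \<in> lists S \<longrightarrow>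
    spine P h (\<lambda>x. x \<in> lists S \<and> length x \<le> K) A u w \<or>
    shortenable cls K (\<lambda>u w. cfg_gen P [Inr A] (u @ h # w)) u w"
proof -
  obtain K where K: "\<And>A \<alpha> s \<beta> w. (A, \<alpha> @ s @ \<beta>) \<in> P \<Longrightarrow> cfg_gen P s w \<Longrightarrow> K < length w \<Longrightarrow>
    (\<exists>p b q z. w = p @ b @ q \<and> length z < length b \<and> length b \<le> K \<and> cls z = cls b \<and>
      cfg_gen P s (p @ z @ q))"
    using cfg_gen_shorten[OF assms] by blast
  let ?any = "\<lambda>_ :: 'a list. True"
  let ?ok = "\<lambda>x. x \<in> lists S \<and> length x \<le> K"
  let ?short = "\<lambda>u w A. shortenable cls K (spine P h ?any A) u w"
  have dichotomy: "spine P h ?ok A u w \<or> ?short u w A"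
    if "spine P h ?any A u w" "u \<in> lists S" "w \<in> lists S" for A u w
    using that
  proof (induction rule: spine.induct)
    case (spine_base A \<alpha> \<beta> u w)
    \<comment> \<open>Rebrackets the production so that the part to the left or to the right of the
      branch becomes the segment \<open>s\<close> in fact \<open>K\<close>.\<close>
    have prod: "(A, [] @ \<alpha> @ (Inl h # \<beta>)) \<in> P" "(A, (\<alpha> @ [Inl h]) @ \<beta> @ []) \<in> P"
      using spine_base.hyps by auto
    consider "length u \<le> K" "length w \<le> K" | "K < length u" | "K < length w" by linarith
    then show ?case
    proof cases
      case 1
      then show ?thesis using spine_base by (auto intro: spine.spine_base)
    next
      case 2
      from K[OF prod(1) spine_base.hyps(2) 2] obtain p b q z where
        *: "u = p @ b @ q" "length z < length b" "length b \<le> K" "cls z = cls b"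
        "cfg_gen P \<alpha> (p @ z @ q)" by blast
      have "spine P h ?any A (p @ z @ q) w"
        using spine_base.hyps(1) *(5) spine_base.hyps(3) by (rule spine.spine_base) auto
      then show ?thesis using * unfolding shortenable_def by blast
    next
      case 3
      from K[OF prod(2) spine_base.hyps(3) 3] obtain p b q z where
        *: "w = p @ b @ q" "length z < length b" "length b \<le> K" "cls z = cls b"
        "cfg_gen P \<beta> (p @ z @ q)" by blast
      have "spine P h ?any A u (p @ z @ q)"
        using spine_base.hyps(1,2) *(5) by (rule spine.spine_base) auto
      then show ?thesis using * unfolding shortenable_def by blast
    qed
  next
    case (spine_step A \<alpha> B \<beta> u w u' w')
    have prod: "(A, [] @ \<alpha> @ (Inr B # \<beta>)) \<in> P" "(A, (\<alpha> @ [Inr B]) @ \<beta> @ []) \<in> P"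
      using spine_step.hyps by auto
    consider "length u \<le> K" "length w \<le> K" | "K < length u" | "K < length w" by linarith
    then show ?case
    proof cases
      case 1
      from spine_step.IH spine_step.prems consider "spine P h ?ok B u' w'" | "?short u' w' B" by auto
      then show ?thesis
      proof cases
        case 1
        then have "spine P h ?ok A (u @ u') (w' @ w)"
          using spine_step \<open>length u \<le> K\<close> \<open>length w \<le> K\<close> by (auto intro!: spine.spine_step)
        then show ?thesis ..
      next
        case 2
        then obtain p b q z where *: "length z < length b" "length b \<le> K" "cls z = cls b"
          "u' = p @ b @ q \<and> spine P h ?any B (p @ z @ q) w' \<or>
           w' = p @ b @ q \<and> spine P h ?any B u' (p @ z @ q)"
          unfolding shortenable_def by blast
        from *(4) have "(u @ u' = (u @ p) @ b @ q \<and> spine P h ?any A ((u @ p) @ z @ q) (w' @ w)) \<or>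
          (w' @ w = p @ b @ q @ w \<and> spine P h ?any A (u @ u') (p @ z @ q @ w))"
          using spine.spine_step[OF spine_step.hyps(1-3), of ?any h "p @ z @ q" w']
            spine.spine_step[OF spine_step.hyps(1-3), of ?any h u' "p @ z @ q"] by auto
        then show ?thesis using * unfolding shortenable_def by blast
      qed
    next
      case 2
      from K[OF prod(1) spine_step.hyps(2) 2] obtain p b q z where
        *: "u = p @ b @ q" "length z < length b" "length b \<le> K" "cls z = cls b"
        "cfg_gen P \<alpha> (p @ z @ q)" by blast
      have "spine P h ?any A ((p @ z @ q) @ u') (w' @ w)"
        using spine_step.hyps(1) *(5) spine_step.hyps(3) _ _ spine_step.hyps(6)
        by (rule spine.spine_step) auto
      then have "spine P h ?any A (p @ z @ q @ u') (w' @ w)" by simp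
      moreover have "u @ u' = p @ b @ q @ u'" using * by simp
      ultimately show ?thesis using * unfolding shortenable_def by blast
    next
      case 3
      from K[OF prod(2) spine_step.hyps(3) 3] obtain p b q z where
        *: "w = p @ b @ q" "length z < length b" "length b \<le> K" "cls z = cls b"
        "cfg_gen P \<beta> (p @ z @ q)" by blast
      have "spine P h ?any A (u @ u') (w' @ p @ z @ q)"
        using spine_step.hyps(1,2) *(5) _ _ spine_step.hyps(6)
        by (rule spine.spine_step) auto
      then have "spine P h ?any A (u @ u') ((w' @ p) @ z @ q)" by simp
      moreover have "w' @ w = (w' @ p) @ b @ q" using * by simp
      ultimately show ?thesis using * unfolding shortenable_def by blast
    qed
  qed
  show ?thesis
  proof (intro exI[of _ K] allI impI, elim conjE)
    fix A u w assume "cfg_gen P [Inr A] (u @ h # w)" "u \<in> lists S" "w \<in> lists S"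
    from dichotomy[OF cfg_gen_spine[OF this(1)] this(2,3)]
    show "spine P h ?ok A u w \<or> shortenable cls K (\<lambda>u w. cfg_gen P [Inr A] (u @ h # w)) u w"
      by (rule disj_forward) (assumption, erule shortenable_mono, rule spine_cfg_gen)
  qed
qed

text \<open>Nonterminals are the states \<open>Some A\<close>, and \<open>None\<close> is reached
  when the branch arrives at \<open>h\<close>. As \<open>ok\<close> admits finitely many pieces,
  there are finitely many edges. Pieces to the right of \<open>h\<close> come from the outside
  inwards; formal inversion turns this into the order of reading.\<close>

lemma rational_transduction_spine:
  assumes "finite P" "finite {x. ok x}" "\<And>x. ok x \<Longrightarrow> x \<in> lists S" "\<And>a. a \<in> S \<Longrightarrow> iv a \<in> S"
  shows "rational_transduction S {(u, word_inv iv w) | u w. spine P h ok A u w}"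
proof -
  let ?inv = "word_inv iv"
  define E1 where "E1 = {(Some A, (u, ?inv w), None :: nat option) | A u w. ok u \<and> ok w \<and>
    (\<exists>\<alpha> \<beta>. (A, \<alpha> @ Inl h # \<beta>) \<in> P \<and> cfg_gen P \<alpha> u \<and> cfg_gen P \<beta> w)}"
  define E2 where "E2 = {(Some A, (u, ?inv w), Some B) | A u w B. ok u \<and> ok w \<and>
    (\<exists>\<alpha> \<beta>. (A, \<alpha> @ Inr B # \<beta>) \<in> P \<and> cfg_gen P \<alpha> u \<and> cfg_gen P \<beta> w)}"
  define E where "E = E1 \<union> E2"
  have "finite E"
  proof -
    let ?N = "\<Union>d\<in>P. Inr -` set (snd d)"
    have "finite ?N" using assms(1) by (intro finite_UN_I finite_vimageI) auto
    moreover have "E \<subseteq> (Some ` fst ` P) \<times> ({x. ok x} \<times> ?inv ` {x. ok x}) \<times> insert None (Some ` ?N)"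
    proof
      fix d assume "d \<in> E"
      then consider "d \<in> E1" | "d \<in> E2" by (auto simp: E_def)
      then show "d \<in> (Some ` fst ` P) \<times> ({x. ok x} \<times> ?inv ` {x. ok x}) \<times> insert None (Some ` ?N)"
      proof cases
        case 1
        then show ?thesis by (force simp: E1_def)
      next
        case 2
        then obtain A u w B \<alpha> \<beta> where d: "d = (Some A, (u, ?inv w), Some B)" "ok u" "ok w"
          "(A, \<alpha> @ Inr B # \<beta>) \<in> P" by (auto simp: E2_def)
        moreover from d(4) have "B \<in> ?N" by force
        moreover from d(4) have "A \<in> fst ` P" by force
        ultimately show ?thesis by blast
      qed
    qed
    ultimately show ?thesis using assms(1,2) by (elim finite_subset) simp
  qed
  have path_spine: "\<exists>w. snd m = ?inv w \<and> spine P h ok A (fst m) w"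
    if "pairs.path E s m t" "s = Some A" "t = None" for s m t A
    using that
  proof (induction arbitrary: A rule: pairs.path.induct)
    case (path_refl s)
    then show ?case by simp
  next
    case (path_step s l r m t)
    from path_step.hyps(1) consider "(s, l, r) \<in> E1" | "(s, l, r) \<in> E2" by (auto simp: E_def)
    then show ?case
    proof cases
      case 1
      \<comment> \<open>No edge leaves \<open>None\<close>, so the path ends here.\<close>
      then have "r = None" by (auto simp: E1_def)
      with path_step.hyps(2) have "m = ([], [])"
        by (cases rule: pairs.path.cases) (auto simp: E_def E1_def E2_def)
      moreover obtain u w where "l = (u, ?inv w)" "spine P h ok A u w"
        using 1 path_step.prems by (auto simp: E1_def intro: spine.spine_base)
      ultimately show ?thesis by auto
    next
      case 2
      then obtain u w B \<alpha> \<beta> where *: "l = (u, ?inv w)" "r = Some B" "ok u" "ok w"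
        "(A, \<alpha> @ Inr B # \<beta>) \<in> P" "cfg_gen P \<alpha> u" "cfg_gen P \<beta> w"
        using path_step.prems by (auto simp: E2_def)
      from path_step.IH[OF *(2) path_step.prems(2)] obtain w' where
        w': "snd m = ?inv w'" "spine P h ok B (fst m) w'" by blast
      have "spine P h ok A (u @ fst m) (w' @ w)" using *(5-7,3,4) w'(2) by (rule spine.spine_step)
      then show ?thesis using w' * by (cases m) (auto simp: word_inv_append intro!: exI[of _ "w' @ w"])
    qed
  qed
  have spine_path: "pairs.path E (Some A) (u, ?inv w) None" if "spine P h ok A u w" for A u w
    using that
  proof (induction rule: spine.induct)
    case (spine_base A \<alpha> \<beta> u w)
    then have "(Some A, (u, ?inv w), None) \<in> E" by (auto simp: E_def E1_def)
    then show ?case by (rule pairs.path_edge)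
  next
    case (spine_step A \<alpha> B \<beta> u w u' w')
    then have "(Some A, (u, ?inv w), Some B) \<in> E" by (auto simp: E_def E2_def)
    from pairs.path_step[OF this spine_step.IH] show ?case by (simp add: word_inv_append)
  qed
  have "{(u, ?inv w) | u w. spine P h ok A u w} = {m. pairs.path E (Some A) m None}"
    using path_spine[OF _ refl refl] spine_path by fastforce
  also have "\<dots> \<in> rational_subsets pair_append ([], []) (lists S \<times> lists S)"
  proof (rule pairs.rational_paths[OF \<open>finite E\<close>])
    fix s x t assume "(s, x, t) \<in> E"
    then obtain u w where "x = (u, ?inv w)" "u \<in> lists S" "w \<in> lists S"
      using assms(3) by (auto simp: E_def E1_def E2_def)
    then show "x \<in> lists S \<times> lists S" using assms(4) by (auto simp: word_inv_def)
  qed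
  finally show ?thesis by (simp add: rational_transduction_def)
qed

section \<open>Combings\<close>

locale group_generators =
  fixes Sig :: "'a set" and iv :: "'a \<Rightarrow> 'a" and G :: "('g, 'b) monoid_scheme" (structure)
    and pi :: "'a list \<Rightarrow> 'g"
  assumes choice: "choice_of_generators Sig iv G pi"
begin

section \<open>Values of words in the group\<close>

sublocale group G
  using choice by (simp add: choice_of_generators_def)

lemma finite_Sig: "finite Sig"
  and iv_mem: "a \<in> Sig \<Longrightarrow> iv a \<in> Sig"
  and iv_iv: "a \<in> Sig \<Longrightarrow> iv (iv a) = a"
  and pi_closed: "u \<in> lists Sig \<Longrightarrow> pi u \<in> carrier G"
  and pi_Nil: "pi [] = \<one>"
  and pi_append: "u \<in> lists Sig \<Longrightarrow> v \<in> lists Sig \<Longrightarrow> pi (u @ v) = pi u \<otimes> pi v"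
  and pi_word_inv: "u \<in> lists Sig \<Longrightarrow> pi (word_inv iv u) = inv (pi u)"
  using choice unfolding choice_of_generators_def by auto

lemma word_inv_lists: "u \<in> lists Sig \<Longrightarrow> word_inv iv u \<in> lists Sig"
  using iv_mem by (auto simp: word_inv_def)

lemma word_inv_word_inv: "u \<in> lists Sig \<Longrightarrow> word_inv iv (word_inv iv u) = u"
  by (induction u) (auto simp: word_inv_def iv_iv)

lemma finite_Sigma_eps: "finite (Sigma_eps Sig)"
  using finite_Sig by (simp add: Sigma_eps_def setcompr_eq_image)

lemma Sigma_eps_lists: "a \<in> Sigma_eps Sig \<Longrightarrow> a \<in> lists Sig"
  by (auto simp: Sigma_eps_def)

lemma Sigma_eps_word_inv: "a \<in> Sigma_eps Sig \<Longrightarrow> word_inv iv a \<in> Sigma_eps Sig"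
  using iv_mem by (auto simp: Sigma_eps_def word_inv_def)

lemma combing_lists: "combing Sig G pi R \<Longrightarrow> u \<in> R \<Longrightarrow> u \<in> lists Sig"
  by (auto simp: combing_def)

lemma pi_factor_eq_iff:
  assumes "p \<in> lists Sig" "q \<in> lists Sig" "b \<in> lists Sig" "z \<in> lists Sig"
  shows "pi (p @ z @ q) = pi (p @ b @ q) \<longleftrightarrow> pi z = pi b"
  using assms by (simp add: pi_append pi_closed)

lemma combing_shortest:
  assumes "combing Sig G pi R" "g \<in> carrier G"
  obtains u where "u \<in> R" "pi u = g" "\<forall>v\<in>R. pi v = g \<longrightarrow> length u \<le> length v"
proof -
  have "g \<in> pi ` R" using assms by (simp add: combing_def)
  then obtain u0 where "u0 \<in> R \<and> pi u0 = g" by blast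
  from ex_has_least_nat[of "\<lambda>u. u \<in> R \<and> pi u = g", OF this] that show ?thesis by blast
qed

text \<open>The separator does not occur in words of \<open>R\<close>, so a separated word
  determines its two halves.\<close>

lemma C_lang_iff:
  assumes "combing Sig G pi R" "h \<notin> Sig"
  shows "u @ h # w \<in> C_lang G pi h R g \<longleftrightarrow> u \<in> R \<and> w \<in> R \<and> pi u \<otimes> g \<otimes> pi w = \<one>"
proof -
  have h: "h \<notin> set u'" if "u' \<in> R" for u'
    using combing_lists[OF assms(1) that] assms(2) by auto
  have "u @ h # w = u' @ h # w' \<longleftrightarrow> u = u' \<and> w = w'" if "u' \<in> R" "w' \<in> R" for u' w'
    using append_Cons_eq_iff[of h u' w' u w] h that by metis
  then show ?thesis unfolding C_lang_def by auto
qed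

lemma mult_eq_one_iff:
  "x \<in> carrier G \<Longrightarrow> y \<in> carrier G \<Longrightarrow> x \<otimes> y = \<one> \<longleftrightarrow> x = inv y"
  by (metis inv_equality inv_closed l_inv)

text \<open>Two elements that fill the same gap in such an equation agree. This turns an exchange
  within one of the context-free languages into an equality of values.\<close>

lemma mult_eq_one_cancel:
  assumes "x \<in> carrier G" "y \<in> carrier G" "g \<in> carrier G" "k \<in> carrier G"
  shows "x \<otimes> g \<otimes> k = \<one> \<Longrightarrow> y \<otimes> g \<otimes> k = \<one> \<Longrightarrow> x = y"
    and "k \<otimes> g \<otimes> x = \<one> \<Longrightarrow> k \<otimes> g \<otimes> y = \<one> \<Longrightarrow> x = y"
  using assms by (simp add: m_assoc mult_eq_one_iff, metis mult_eq_one_iff m_closed inv_inv)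

text \<open>The grammar pairs words of value \<open>g\<close> with words of value
  \<open>inv g\<close>. If both are shortest in \<open>R\<close>, neither can be shortened, so their
  spine is bounded. The left halves of all bounded spines form the domain of a rational
  transduction, hence a regular language.\<close>

lemma regular_subcombing:
  assumes R: "combing Sig G pi R" and h: "h \<notin> Sig"
    and cf: "context_free (insert h Sig) (C_lang G pi h R \<one>)"
  obtains R1 where "R1 \<subseteq> R" "regular_lang Sig R1" "combing Sig G pi R1"
proof -
  obtain P S0 where P: "finite P" "cfg_lang P S0 = C_lang G pi h R \<one>"
    using cf unfolding context_free_def by blast
  have gen: "cfg_gen P [Inr S0] (u @ h # w) \<longleftrightarrow> u \<in> R \<and> w \<in> R \<and> pi u \<otimes> \<one> \<otimes> pi w = \<one>" for u w
    using P(2) C_lang_iff[OF R h, of u w \<one>] unfolding cfg_lang_def by blast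
  \<comment> \<open>A constant class function suffices here, since the grammar itself keeps
    shortened words in \<open>R\<close>.\<close>
  obtain K where K_all: "\<forall>A u w. cfg_gen P [Inr A] (u @ h # w) \<and> u \<in> lists Sig \<and> w \<in> lists Sig \<longrightarrow>
    spine P h (\<lambda>x. x \<in> lists Sig \<and> length x \<le> K) A u w \<or>
    shortenable (\<lambda>_. ()) K (\<lambda>u w. cfg_gen P [Inr A] (u @ h # w)) u w"
    using spine_bounded_or_shortenable[OF P(1), of "\<lambda>_. ()" h Sig] by (auto elim: exE)
  note K = K_all[rule_format, OF conjI[OF _ conjI]]
  let ?ok = "\<lambda>x. x \<in> lists Sig \<and> length x \<le> K"
  let ?T = "{(u, word_inv iv w) | u w. spine P h ?ok S0 u w}"
  have "rational_transduction Sig ?T"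
    by (rule rational_transduction_spine)
      (use P finite_Sig iv_mem finite_lists_length_le in \<open>auto simp: lists_eq_set\<close>)
  then have "regular_lang Sig (Domain ?T)" by (rule regular_Domain)
  moreover have sub: "Domain ?T \<subseteq> R"
    using spine_cfg_gen[of P h ?ok S0] gen by fastforce
  moreover have "g \<in> pi ` Domain ?T" if g: "g \<in> carrier G" for g
  proof -
    obtain u where u: "u \<in> R" "pi u = g" "\<forall>v\<in>R. pi v = g \<longrightarrow> length u \<le> length v"
      using R g by (rule combing_shortest)
    obtain w where w: "w \<in> R" "pi w = inv g"
        "\<forall>v\<in>R. pi v = inv g \<longrightarrow> length w \<le> length v"
      using R inv_closed[OF g] by (rule combing_shortest)
    note lists = combing_lists[OF R]
    have uw: "cfg_gen P [Inr S0] (u @ h # w)"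
      using g u w by (simp add: gen)
    have "spine P h ?ok S0 u w"
    proof (rule ccontr)
      assume "\<not> ?thesis"
      with K[OF uw lists[OF u(1)] lists[OF w(1)]] obtain p b q z where short: "length z < length b"
        and alt: "u = p @ b @ q \<and> cfg_gen P [Inr S0] ((p @ z @ q) @ h # w) \<or>
         w = p @ b @ q \<and> cfg_gen P [Inr S0] (u @ h # p @ z @ q)"
        unfolding shortenable_def by blast
      from alt show False
      proof (elim disjE conjE)
        assume *: "u = p @ b @ q" "cfg_gen P [Inr S0] ((p @ z @ q) @ h # w)"
        then have "p @ z @ q \<in> R" "pi (p @ z @ q) \<otimes> \<one> \<otimes> pi w = \<one>" using gen by blast+
        moreover from this(2) have "pi (p @ z @ q) = g"
          using uw[unfolded gen] u w g lists[OF \<open>p @ z @ q \<in> R\<close>]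
          by (metis mult_eq_one_cancel(1) inv_closed one_closed pi_closed)
        ultimately have "length u \<le> length (p @ z @ q)" using u(3) by blast
        then show False using * short by simp
      next
        assume *: "w = p @ b @ q" "cfg_gen P [Inr S0] (u @ h # p @ z @ q)"
        then have "p @ z @ q \<in> R" "pi u \<otimes> \<one> \<otimes> pi (p @ z @ q) = \<one>" using gen by blast+
        moreover from this(2) have "pi (p @ z @ q) = inv g"
          using uw[unfolded gen] u w g lists[OF \<open>p @ z @ q \<in> R\<close>]
          by (metis mult_eq_one_cancel(2) inv_closed one_closed pi_closed)
        ultimately have "length w \<le> length (p @ z @ q)" using w(3) by blast
        then show False using * short by simp
      qed
    qed
    then have "u \<in> Domain ?T" by blast
    then show ?thesis using u(2) by blast
  qed
  moreover have "pi ` Domain ?T \<subseteq> carrier G"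
    using sub pi_closed combing_lists[OF R] by blast
  ultimately have "combing Sig G pi (Domain ?T)"
    using combing_lists[OF R] unfolding combing_def by blast
  with sub \<open>regular_lang Sig (Domain ?T)\<close> show ?thesis by (rule that)
qed

section \<open>Trimming the regular combing\<close>

definition mult_relation :: "'a list set \<Rightarrow> 'a list set \<Rightarrow> 'g \<Rightarrow> ('a list \<times> 'a list) set" where
  "mult_relation X Y g = {(u, v). u \<in> X \<and> v \<in> Y \<and> pi u \<otimes> g = pi v}"

text \<open>A shortest word of \<open>R1\<close> with a given value has no factor in
  \<open>V\<close>: exchanging the factor for the shorter \<open>z\<close> would keep the value, and
  would keep the word in \<open>R1\<close> because the contexts agree. So every group element
  retains a representative.\<close>

lemma combing_trim:
  assumes "regular_lang Sig R1" "combing Sig G pi R1" "finite V"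
    and V: "\<And>b. b \<in> V \<Longrightarrow> b \<in> lists Sig \<and> (\<exists>z\<in>lists Sig. length z < length b \<and> pi z = pi b \<and>
      syntactic_class R1 z = syntactic_class R1 b)"
  defines "R2 \<equiv> R1 - {p @ b @ q | p b q. p \<in> lists Sig \<and> b \<in> V \<and> q \<in> lists Sig}"
  shows "regular_lang Sig R2" "combing Sig G pi R2"
proof -
  have "V \<subseteq> lists Sig" using V by blast
  then show "regular_lang Sig R2" unfolding R2_def using assms finite_Sig
    by (intro regular_Diff regular_factors)
  have "g \<in> pi ` R2" if g: "g \<in> carrier G" for g
  proof -
    obtain u where u: "u \<in> R1" "pi u = g" "\<forall>v\<in>R1. pi v = g \<longrightarrow> length u \<le> length v"
      using assms(2) g by (rule combing_shortest)
    have "u \<in> R2"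
    proof (rule ccontr)
      assume "u \<notin> R2"
      then obtain p b q where pbq: "u = p @ b @ q" "p \<in> lists Sig" "b \<in> V" "q \<in> lists Sig"
        using u(1) unfolding R2_def by blast
      from V[OF pbq(3)] obtain z where z: "b \<in> lists Sig" "z \<in> lists Sig" "length z < length b"
        "pi z = pi b" "syntactic_class R1 z = syntactic_class R1 b" by blast
      have "p @ z @ q \<in> R1" using syntactic_class_cong[OF z(5)] u(1) pbq(1) by blast
      moreover have "pi (p @ z @ q) = g" using pi_factor_eq_iff pbq z u(2) by blast
      ultimately have "length u \<le> length (p @ z @ q)" using u(3) by blast
      then show False using pbq z by simp
    qed
    then show ?thesis using u(2) by blast
  qed
  moreover have "R2 \<subseteq> R1" by (auto simp: R2_def)
  ultimately show "combing Sig G pi R2" using assms(2) unfolding combing_def by blast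
qed

text \<open>The second round uses contexts in \<open>R1\<close> as classes. Bounded spines are now
  needed for all pairs of words and not just for shortest ones; deleting the words with exchangeable
  factors of moderate length achieves this. The grammars remain those for \<open>R\<close>.\<close>

lemma rational_subcombing:
  assumes R: "combing Sig G pi R" and h: "h \<notin> Sig"
    and cf: "\<forall>a\<in>Sigma_eps Sig. context_free (insert h Sig) (C_lang G pi h R (pi a))"
  obtains R2 where "regular_lang Sig R2" "combing Sig G pi R2"
    "\<forall>a\<in>Sigma_eps Sig.
      rational_transduction Sig (mult_relation R2 (word_inv iv ` R2) (pi a))"
proof -
  have "context_free (insert h Sig) (C_lang G pi h R \<one>)"
    using cf by (simp add: Sigma_eps_def pi_Nil)
  with R h obtain R1 where R1: "R1 \<subseteq> R" "regular_lang Sig R1" "combing Sig G pi R1"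
    by (rule regular_subcombing)
  \<comment> \<open>Bundles grammar, start symbol and bound, so that a single choice provides all
    three as functions of \<open>a\<close>.\<close>
  define suitable where "suitable a P S0 K \<longleftrightarrow> finite P \<and> cfg_lang P S0 = C_lang G pi h R (pi a) \<and>
    (\<forall>A u w. cfg_gen P [Inr A] (u @ h # w) \<and> u \<in> lists Sig \<and> w \<in> lists Sig \<longrightarrow>
      spine P h (\<lambda>x. x \<in> lists Sig \<and> length x \<le> K) A u w \<or>
      shortenable (syntactic_class R1) K (\<lambda>u w. cfg_gen P [Inr A] (u @ h # w)) u w)" for a P S0 K
  have "\<exists>P S0 K. suitable a P S0 K" if a: "a \<in> Sigma_eps Sig" for a
  proof -
    have "context_free (insert h Sig) (C_lang G pi h R (pi a))" using cf a by blast
    then obtain P S0 where P: "finite P" "cfg_lang P S0 = C_lang G pi h R (pi a)"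
      unfolding context_free_def by blast
    from spine_bounded_or_shortenable[OF P(1) finite_syntactic_classes[OF R1(2)], of h Sig]
    have "\<exists>K. suitable a P S0 K" unfolding suitable_def using P by simp
    then show ?thesis by blast
  qed
  then obtain P S0 K where suitable: "\<And>a. a \<in> Sigma_eps Sig \<Longrightarrow> suitable a (P a) (S0 a) (K a)"
    by metis
  have P: "finite (P a)" "cfg_lang (P a) (S0 a) = C_lang G pi h R (pi a)"
    and K: "\<And>A u w. cfg_gen (P a) [Inr A] (u @ h # w) \<Longrightarrow> u \<in> lists Sig \<Longrightarrow> w \<in> lists Sig \<Longrightarrow>
      spine (P a) h (\<lambda>x. x \<in> lists Sig \<and> length x \<le> K a) A u w \<or>
      shortenable (syntactic_class R1) (K a) (\<lambda>u w. cfg_gen (P a) [Inr A] (u @ h # w)) u w"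
    if "a \<in> Sigma_eps Sig" for a
    using suitable[OF that] unfolding suitable_def by simp_all
  \<comment> \<open>The factors for all \<open>a\<close> are collected in one finite set, so that a
    single combing serves every \<open>a\<close>.\<close>
  define V where "V = {b \<in> \<Union>a\<in>Sigma_eps Sig. {b. b \<in> lists Sig \<and> length b \<le> K a}.
    \<exists>z\<in>lists Sig. length z < length b \<and> pi z = pi b \<and>
      syntactic_class R1 z = syntactic_class R1 b}"
  have short_words: "finite {x. x \<in> lists Sig \<and> length x \<le> k}" for k
    using finite_lists_length_le[OF finite_Sig] by (simp add: lists_eq_set)
  have "finite V" unfolding V_def
    by (rule finite_subset[OF Collect_restrict]) (intro finite_UN_I finite_Sigma_eps short_words)
  define R2 where "R2 = R1 - {p @ b @ q | p b q. p \<in> lists Sig \<and> b \<in> V \<and> q \<in> lists Sig}"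
  have R2: "regular_lang Sig R2" "combing Sig G pi R2"
    unfolding R2_def by (rule combing_trim[OF R1(2,3) \<open>finite V\<close>]; auto simp: V_def)+
  note lists = combing_lists[OF R] and lists2 = combing_lists[OF R2(2)]
  have "rational_transduction Sig (mult_relation R2 (word_inv iv ` R2) (pi a))"
    if a: "a \<in> Sigma_eps Sig" for a
  proof -
    let ?ok = "\<lambda>x. x \<in> lists Sig \<and> length x \<le> K a"
    let ?T = "{(u, word_inv iv w) | u w. spine (P a) h ?ok (S0 a) u w}"
    have pia: "pi a \<in> carrier G" using a Sigma_eps_lists pi_closed by blast
    have gen: "cfg_gen (P a) [Inr (S0 a)] (u @ h # w) \<longleftrightarrow>
      u \<in> R \<and> w \<in> R \<and> pi u \<otimes> pi a \<otimes> pi w = \<one>" for u w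
      using P(2)[OF a] C_lang_iff[OF R h, of u w "pi a"] unfolding cfg_lang_def by blast
    have val: "pi u \<otimes> pi a \<otimes> pi w = \<one> \<longleftrightarrow> pi u \<otimes> pi a = pi (word_inv iv w)"
      if "u \<in> lists Sig" "w \<in> lists Sig" for u w
      using that pia by (simp add: mult_eq_one_iff pi_closed pi_word_inv)
    \<comment> \<open>The exchanged word is only known to lie in \<open>R\<close> and to have the
      same value. Cancelling the common prefix and suffix equates the values of \<open>z\<close> and
      \<open>b\<close>, which puts \<open>b\<close> into \<open>V\<close>.\<close>
    have no_factor: False
      if "p @ b @ q \<in> R2" "p @ z @ q \<in> R" "pi (p @ z @ q) = pi (p @ b @ q)"
        "length z < length b" "length b \<le> K a" "syntactic_class R1 z = syntactic_class R1 b" for p b q z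
    proof -
      have l: "p \<in> lists Sig" "b \<in> lists Sig" "q \<in> lists Sig" "z \<in> lists Sig"
        using lists2[OF that(1)] lists[OF that(2)] by auto
      then have "pi z = pi b" using that(3) pi_factor_eq_iff by blast
      then have "b \<in> V" using that l a unfolding V_def by blast
      then show False using that(1) l unfolding R2_def by blast
    qed
    have "spine (P a) h ?ok (S0 a) u w"
      if uw: "u \<in> R2" "w \<in> R2" "pi u \<otimes> pi a \<otimes> pi w = \<one>" for u w
    proof (rule ccontr)
      assume "\<not> ?thesis"
      moreover have "cfg_gen (P a) [Inr (S0 a)] (u @ h # w)"
        using uw R1(1) unfolding gen R2_def by blast
      ultimately obtain p b q z where short: "length z < length b" "length b \<le> K a"
          "syntactic_class R1 z = syntactic_class R1 b"
        and alt: "u = p @ b @ q \<and> cfg_gen (P a) [Inr (S0 a)] ((p @ z @ q) @ h # w) \<or>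
         w = p @ b @ q \<and> cfg_gen (P a) [Inr (S0 a)] (u @ h # p @ z @ q)"
        using K[OF a _ lists2[OF uw(1)] lists2[OF uw(2)]] unfolding shortenable_def by blast
      note closed = pi_closed[OF lists] pi_closed[OF lists2]
      from alt show False
      proof (elim disjE conjE)
        assume *: "u = p @ b @ q" "cfg_gen (P a) [Inr (S0 a)] ((p @ z @ q) @ h # w)"
        then have z: "p @ z @ q \<in> R" "pi (p @ z @ q) \<otimes> pi a \<otimes> pi w = \<one>" using gen by blast+
        have "pi (p @ z @ q) = pi (p @ b @ q)"
          by (rule mult_eq_one_cancel(1)[OF closed(1)[OF z(1)] _ pia closed(2)[OF uw(2)] z(2)])
            (use uw * closed in auto)
        then show False using no_factor uw(1) z(1) short * by blast
      next
        assume *: "w = p @ b @ q" "cfg_gen (P a) [Inr (S0 a)] (u @ h # p @ z @ q)"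
        then have z: "p @ z @ q \<in> R" "pi u \<otimes> pi a \<otimes> pi (p @ z @ q) = \<one>" using gen by blast+
        have "pi (p @ z @ q) = pi (p @ b @ q)"
          by (rule mult_eq_one_cancel(2)[OF closed(1)[OF z(1)] _ pia closed(2)[OF uw(1)] z(2)])
            (use uw * closed in auto)
        then show False using no_factor uw(2) z(1) short * by blast
      qed
    qed
    \<comment> \<open>\<open>?T\<close> contains all required pairs but may also involve other words
      of \<open>R\<close>; restricting it to \<open>R2\<close> and the inverses of \<open>R2\<close>
      gives equality.\<close>
    then have "mult_relation R2 (word_inv iv ` R2) (pi a) \<subseteq> ?T"
      using val lists2 unfolding mult_relation_def by blast
    moreover have "pi u \<otimes> pi a = pi v" if "(u, v) \<in> ?T" for u v
    proof -
      from that obtain w where w: "v = word_inv iv w" "spine (P a) h ?ok (S0 a) u w" by blast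
      have "u \<in> R \<and> w \<in> R \<and> pi u \<otimes> pi a \<otimes> pi w = \<one>"
        using spine_cfg_gen[OF w(2)] unfolding gen .
      then show ?thesis using val lists w(1) by blast
    qed
    then have "?T \<inter> R2 \<times> word_inv iv ` R2 \<subseteq> mult_relation R2 (word_inv iv ` R2) (pi a)"
      unfolding mult_relation_def by blast
    moreover have "mult_relation R2 (word_inv iv ` R2) (pi a) \<subseteq> R2 \<times> word_inv iv ` R2"
      unfolding mult_relation_def by blast
    ultimately have "mult_relation R2 (word_inv iv ` R2) (pi a) = ?T \<inter> R2 \<times> word_inv iv ` R2"
      by (intro subset_antisym Int_greatest)
    moreover have "rational_transduction Sig ?T"
      by (rule rational_transduction_spine) (use P(1)[OF a] short_words iv_mem in auto)
    ultimately show ?thesis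
      using R2(1) regular_word_inv[OF R2(1) iv_mem] by (simp add: rational_transduction_restrict)
  qed
  with R2 show ?thesis using that by blast
qed

text \<open>Since \<open>Y\<close> represents every group element, some word of \<open>Y\<close> has
  the value of \<open>u\<close> and can serve as intermediate word.\<close>

lemma mult_relation_relcomp:
  assumes "X \<subseteq> lists Sig" "pi ` Y = carrier G" "g \<in> carrier G"
  shows "mult_relation X Z g = mult_relation X Y \<one> O mult_relation Y Z g"
proof (intro subset_antisym subrelI)
  fix u v assume "(u, v) \<in> mult_relation X Z g"
  moreover from this have u: "pi u \<in> carrier G"
    using assms(1) pi_closed unfolding mult_relation_def by blast
  moreover from u obtain y where "y \<in> Y" "pi y = pi u" using assms(2) by (metis imageE)
  ultimately show "(u, v) \<in> mult_relation X Y \<one> O mult_relation Y Z g"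
    by (auto simp: mult_relation_def intro!: relcompI[of _ y])
next
  fix u v assume "(u, v) \<in> mult_relation X Y \<one> O mult_relation Y Z g"
  then obtain y where "u \<in> X" "v \<in> Z" "pi u \<otimes> \<one> = pi y" "pi y \<otimes> g = pi v"
    by (auto simp: mult_relation_def)
  moreover from this have "pi u \<in> carrier G" using assms(1) pi_closed by blast
  ultimately show "(u, v) \<in> mult_relation X Z g" by (simp add: mult_relation_def)
qed

lemma mult_relation_converse:
  assumes "X \<subseteq> lists Sig" "Y \<subseteq> lists Sig" "g \<in> carrier G"
  shows "(mult_relation X Y g)\<inverse> = mult_relation Y X (inv g)"
proof -
  have "pi u \<otimes> g = pi v \<longleftrightarrow> pi v \<otimes> inv g = pi u" if "u \<in> X" "v \<in> Y" for u v
  proof -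
    have "pi u \<in> carrier G" "pi v \<in> carrier G" using that assms pi_closed by blast+
    then show ?thesis using assms(3) inv_solve_right[of "pi v" "pi u" g]
      by (metis inv_solve_right inv_solve_right')
  qed
  then show ?thesis by (auto simp: mult_relation_def)
qed

lemma context_free_imp_async_automatic:
  assumes "combing Sig G pi R" "h \<notin> Sig"
    and "\<forall>a\<in>Sigma_eps Sig. context_free (insert h Sig) (C_lang G pi h R (pi a))"
  shows "\<exists>R'. async_automatic_wrt Sig G pi R' \<and> (\<forall>w\<in>R'. word_inv iv w \<in> R')"
proof -
  obtain X where X: "regular_lang Sig X" "combing Sig G pi X"
    and rat: "\<forall>a\<in>Sigma_eps Sig.
      rational_transduction Sig (mult_relation X (word_inv iv ` X) (pi a))"
    using assms by (rule rational_subcombing)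
  define Y where "Y = word_inv iv ` X"
  have sub: "X \<subseteq> lists Sig" "Y \<subseteq> lists Sig" and piX: "pi ` X = carrier G"
    using X(2) word_inv_lists by (auto simp: combing_def Y_def)
  have piY: "pi ` Y = carrier G"
  proof (intro subset_antisym subsetI)
    fix g assume "g \<in> carrier G"
    then obtain u where "u \<in> X" "pi u = inv g" using piX inv_closed by (metis imageE)
    moreover from this have "u \<in> lists Sig" using sub by blast
    ultimately have "pi (word_inv iv u) = g" using \<open>g \<in> carrier G\<close> by (simp add: pi_word_inv)
    then show "g \<in> pi ` Y" unfolding Y_def using \<open>u \<in> X\<close> by blast
  next
    fix g assume "g \<in> pi ` Y"
    then show "g \<in> carrier G" using sub(2) pi_closed by blast
  qed
  have eps: "[] \<in> Sigma_eps Sig" by (simp add: Sigma_eps_def)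
  have XY: "rational_transduction Sig (mult_relation X Y (pi a))" if "a \<in> Sigma_eps Sig" for a
    using rat that by (simp add: Y_def)
  \<comment> \<open>Obtained by reversing multiplication by the formal inverse of \<open>a\<close>,
    which again lies in \<open>Sigma_eps Sig\<close>.\<close>
  have YX: "rational_transduction Sig (mult_relation Y X (pi a))" if "a \<in> Sigma_eps Sig" for a
  proof -
    have a: "a \<in> lists Sig" "pi a \<in> carrier G" using that Sigma_eps_lists pi_closed by auto
    then have "mult_relation Y X (pi a) = (mult_relation X Y (pi (word_inv iv a)))\<inverse>"
      using sub by (simp add: mult_relation_converse pi_word_inv)
    then show ?thesis
      using rational_transduction_converse[OF XY[OF Sigma_eps_word_inv[OF that]]] by simp
  qed
  have "rational_transduction Sig (mult_relation (X \<union> Y) (X \<union> Y) (pi a))"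
    if a: "a \<in> Sigma_eps Sig" for a
  proof -
    have pia: "pi a \<in> carrier G" using a Sigma_eps_lists pi_closed by blast
    \<comment> \<open>So far there are only transductions between \<open>X\<close> and
      \<open>Y\<close>, so a pair within one half takes a detour through the other.\<close>
    have "mult_relation X X (pi a) = mult_relation X Y (pi []) O mult_relation Y X (pi a)"
      using sub(1) piY pia unfolding pi_Nil by (rule mult_relation_relcomp)
    then have XX: "rational_transduction Sig (mult_relation X X (pi a))"
      using rational_transduction_relcomp[OF XY[OF eps] YX[OF a]] by simp
    have "mult_relation Y Y (pi a) = mult_relation Y X (pi []) O mult_relation X Y (pi a)"
      using sub(2) piX pia unfolding pi_Nil by (rule mult_relation_relcomp)
    then have YY: "rational_transduction Sig (mult_relation Y Y (pi a))"
      using rational_transduction_relcomp[OF YX[OF eps] XY[OF a]] by simp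
    have "mult_relation (X \<union> Y) (X \<union> Y) (pi a) =
      (mult_relation X X (pi a) \<union> mult_relation X Y (pi a)) \<union>
      (mult_relation Y X (pi a) \<union> mult_relation Y Y (pi a))"
      by (auto simp: mult_relation_def)
    then show ?thesis using XX XY[OF a] YX[OF a] YY
      by (simp add: rational_transduction_Un)
  qed
  moreover have "regular_lang Sig (X \<union> Y)"
    using X(1) regular_word_inv[OF X(1) iv_mem] unfolding regular_lang_def Y_def by (rule rs_union)
  moreover have "combing Sig G pi (X \<union> Y)"
    using sub piX piY by (auto simp: combing_def image_Un)
  ultimately have "async_automatic_wrt Sig G pi (X \<union> Y)"
    by (simp add: async_automatic_wrt_def mult_relation_def)
  moreover have "\<forall>w\<in>X \<union> Y. word_inv iv w \<in> X \<union> Y"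
  proof
    fix w assume "w \<in> X \<union> Y"
    then consider "w \<in> X" | u where "u \<in> X" "w = word_inv iv u" by (auto simp: Y_def)
    then show "word_inv iv w \<in> X \<union> Y"
    proof cases
      case 1
      then show ?thesis by (simp add: Y_def)
    next
      case 2
      then have "word_inv iv w = u" using sub(1) by (simp add: subset_iff word_inv_word_inv)
      then show ?thesis using 2 by simp
    qed
  qed
  ultimately show ?thesis by blast
qed

text \<open>Closure under inversion lets the right half of a separated word be replaced by its
  inverse without leaving \<open>R\<close>. The language is therefore exactly the one that
  \<open>context_free_transduction\<close> builds from the relation for \<open>a\<close>.\<close>

lemma async_automatic_imp_context_free:
  assumes R: "async_automatic_wrt Sig G pi R" and inv: "\<And>w. w \<in> R \<Longrightarrow> word_inv iv w \<in> R"
    and a: "a \<in> Sigma_eps Sig"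
  shows "context_free (insert h Sig) (C_lang G pi h R (pi a))"
proof -
  let ?T = "{(u, w). u \<in> R \<and> w \<in> R \<and> pi u \<otimes> pi a = pi w}"
  have lists: "u \<in> lists Sig" if "u \<in> R" for u
    using that R combing_lists by (auto simp: async_automatic_wrt_def)
  have pia: "pi a \<in> carrier G" using a Sigma_eps_lists pi_closed by blast
  have val: "pi u \<otimes> pi a \<otimes> pi w = \<one> \<longleftrightarrow> pi u \<otimes> pi a = pi (word_inv iv w)"
    if "u \<in> R" "w \<in> R" for u w
    using that pia by (simp add: mult_eq_one_iff pi_closed pi_word_inv lists)
  have "C_lang G pi h R (pi a) = {u @ [h] @ word_inv iv v | u v. (u, v) \<in> ?T}"
  proof (intro subset_antisym subsetI)
    fix x assume "x \<in> C_lang G pi h R (pi a)"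
    then obtain u w where "x = u @ [h] @ w" "u \<in> R" "w \<in> R" "pi u \<otimes> pi a \<otimes> pi w = \<one>"
      by (auto simp: C_lang_def)
    then have "x = u @ [h] @ word_inv iv (word_inv iv w)" "(u, word_inv iv w) \<in> ?T"
      using inv val by (simp_all add: word_inv_word_inv lists)
    then show "x \<in> {u @ [h] @ word_inv iv v | u v. (u, v) \<in> ?T}" by blast
  next
    fix x assume "x \<in> {u @ [h] @ word_inv iv v | u v. (u, v) \<in> ?T}"
    then obtain u v where "x = u @ [h] @ word_inv iv v" "u \<in> R" "v \<in> R" "pi u \<otimes> pi a = pi v"
      by blast
    moreover from this have "pi u \<otimes> pi a \<otimes> pi (word_inv iv v) = \<one>"
      using val[of u "word_inv iv v"] inv by (metis word_inv_word_inv lists)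
    ultimately show "x \<in> C_lang G pi h R (pi a)"
      unfolding C_lang_def using inv by blast
  qed
  moreover have "rational_transduction Sig ?T"
    using R a by (simp add: async_automatic_wrt_def)
  ultimately show ?thesis using context_free_transduction[of Sig ?T iv h] iv_mem by simp
qed

end

theorem theorem1p3:
  fixes Sig :: "'a set" and iv :: "'a \<Rightarrow> 'a" and G :: "('g, 'b) monoid_scheme"
    and pi :: "'a list \<Rightarrow> 'g" and hash :: 'a
  assumes "choice_of_generators Sig iv G pi"
    and "hash \<notin> Sig"
  shows "(\<exists>R. combing Sig G pi R \<and>
            (\<forall>a \<in> Sigma_eps Sig. context_free (insert hash Sig) (C_lang G pi hash R (pi a))))
         \<longleftrightarrow>
         (\<exists>R'. async_automatic_wrt Sig G pi R' \<and> (\<forall>w \<in> R'. word_inv iv w \<in> R'))"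
proof -
  interpret group_generators Sig iv G pi
    by unfold_locales (rule assms(1))
  show ?thesis
  proof
    assume "\<exists>R. combing Sig G pi R \<and>
      (\<forall>a \<in> Sigma_eps Sig. context_free (insert hash Sig) (C_lang G pi hash R (pi a)))"
    then show "\<exists>R'. async_automatic_wrt Sig G pi R' \<and> (\<forall>w \<in> R'. word_inv iv w \<in> R')"
      using context_free_imp_async_automatic[OF _ assms(2)] by blast
  next
    assume "\<exists>R'. async_automatic_wrt Sig G pi R' \<and> (\<forall>w \<in> R'. word_inv iv w \<in> R')"
    then obtain R where R: "async_automatic_wrt Sig G pi R" "\<And>w. w \<in> R \<Longrightarrow> word_inv iv w \<in> R"
      by blast
    moreover have "combing Sig G pi R" using R(1) by (simp add: async_automatic_wrt_def)
    ultimately show "\<exists>R. combing Sig G pi R \<and>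
      (\<forall>a \<in> Sigma_eps Sig. context_free (insert hash Sig) (C_lang G pi hash R (pi a)))"
      using async_automatic_imp_context_free by blast
  qed
qed

end
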